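(* Let $G$ be a Lie group with Lie algebra $\mathfrak g$. On $\mathfrak g_2^*\times\mathfrak g_3\ni(\nu,\xi)$, regarded as the dual of the Lie algebra $\mathfrak g\circledS\mathfrak g^*$ of $G\circledS\mathfrak g^*$, the Lie–Poisson bracket is $$\{F,H\}(\nu,\xi)=\Big\langle\nu,\Big[\frac{\delta F}{\delta\nu},\frac{\delta H}{\delta\nu}\Big]\Big\rangle+\Big\langle\xi,ad^*_{\frac{\delta H}{\delta\nu}}\frac{\delta F}{\delta\xi}-ad^*_{\frac{\delta F}{\delta\nu}}\frac{\delta H}{\delta\xi}\Big\rangle,$$ and it defines, for each function $H$, the Hamiltonian vector field $X_H$ by $\{F,H\}=-\langle dF,X_H\rangle$ (for all $F$), whose components are the Lie–Poisson equations $$\frac{d\nu}{dt}=ad^*_{\frac{\delta H}{\delta\nu}}\nu-ad^*_\xi\frac{\delta H}{\delta\xi},\qquad \frac{d\xi}{dt}=\Big[\xi,\frac{\delta H}{\delta\nu}\Big].$$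
   Context: Conventions. $G$ is a (finite-dimensional) Lie group, $\mathfrak g=T_eG$, $\mathfrak g^*$ its dual, $\mathfrak g^{**}=\mathfrak g$; subscripts on copies are only labels. $Ad_g$ is the tangent map at $e$ of $h\mapsto g^{-1}hg$; $\langle Ad^*_g\mu,\xi\rangle=\langle\mu,Ad_{g^{-1}}\xi\rangle$. The Lie bracket is $[\xi,\eta]=ad_\xi\eta=\frac{d}{dt}|_{t=0}Ad_{\exp(t\xi)}\eta$ (the bracket of right invariant vector fields). $\langle ad^*_\xi\mu,\eta\rangle=\langle\mu,[\xi,\eta]\rangle$. Partial derivatives: $\delta H/\delta\nu\in\mathfrak g$, $\delta H/\delta\xi\in\mathfrak g^*$. $G\circledS\mathfrak g^*$ is $G\times\mathfrak g^*$ with multiplication $(g,\mu)(h,\nu)=(gh,\mu+Ad^*_{g^{-1}}\nu)$; its Lie algebra $\mathfrak g\circledS\mathfrak g^*$ has bracket $[(\xi,\mu),(\eta,\nu)]=([\xi,\eta],ad^*_\eta\mu-ad^*_\xi\nu)$. For a Lie algebra $\mathfrak k$ the Lie–Poisson bracket on $\mathfrak k^*$ is $\{F,K\}(\alpha)=\langle\alpha,[\delta F/\delta\alpha,\delta K/\delta\alpha]_{\mathfrak k}\rangle$. *)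

theory Defs
  imports "HOL-Analysis.Analysis" "HOL-Algebra.Group"
begin

section \<open>Smooth maps and manifolds\<close>

text \<open>
  Iterated directional derivatives; on open subsets of finite-dimensional spaces, the only
  case used here, this is the usual notion of class \<open>C\<^sup>k\<close>.
\<close>

primrec k_smooth_on :: "nat \<Rightarrow> 'a::real_normed_vector set \<Rightarrow> ('a \<Rightarrow> 'b::real_normed_vector) \<Rightarrow> bool" where
  "k_smooth_on 0 S f \<longleftrightarrow> continuous_on S f"
| "k_smooth_on (Suc k) S f \<longleftrightarrow>
     (\<forall>x\<in>S. f differentiable (at x)) \<and> (\<forall>v. k_smooth_on k S (\<lambda>x. frechet_derivative f (at x) v))"

definition smooth_on :: "'a::real_normed_vector set \<Rightarrow> ('a \<Rightarrow> 'b::real_normed_vector) \<Rightarrow> bool" where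
  "smooth_on S f \<longleftrightarrow> (\<forall>k. k_smooth_on k S f)"

type_synonym ('m, 'v) chart = "'m set \<times> ('m \<Rightarrow> 'v)"

abbreviation chart_inv :: "('m, 'v) chart \<Rightarrow> 'v \<Rightarrow> 'm" where
  "chart_inv \<kappa> \<equiv> inv_into (fst \<kappa>) (snd \<kappa>)"

definition smooth_manifold :: "'m topology \<Rightarrow> ('m, 'v::euclidean_space) chart set \<Rightarrow> bool" where
  "smooth_manifold T A \<longleftrightarrow>
     Hausdorff_space T \<and>
     (\<exists>\<B>. countable \<B> \<and> (\<forall>B\<in>\<B>. openin T B) \<and>
        (\<forall>W x. openin T W \<and> x \<in> W \<longrightarrow> (\<exists>B\<in>\<B>. x \<in> B \<and> B \<subseteq> W))) \<and>
     (\<Union>\<kappa>\<in>A. fst \<kappa>) = topspace T \<and>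
     (\<forall>(U, \<phi>)\<in>A. openin T U \<and> open (\<phi> ` U) \<and>
        homeomorphic_map (subtopology T U) (top_of_set (\<phi> ` U)) \<phi>) \<and>
     (\<forall>(U, \<phi>)\<in>A. \<forall>(V, \<psi>)\<in>A. smooth_on (\<phi> ` (U \<inter> V)) (\<psi> \<circ> inv_into U \<phi>))"

definition smooth_map ::
  "'m topology \<Rightarrow> ('m, 'v::real_normed_vector) chart set \<Rightarrow>
   'n topology \<Rightarrow> ('n, 'w::real_normed_vector) chart set \<Rightarrow> ('m \<Rightarrow> 'n) \<Rightarrow> bool" where
  "smooth_map S A T B f \<longleftrightarrow>
     continuous_map S T f \<and>
     (\<forall>(U, \<phi>)\<in>A. \<forall>(V, \<psi>)\<in>B. smooth_on (\<phi> ` (U \<inter> f -` V)) (\<psi> \<circ> f \<circ> inv_into U \<phi>))"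

definition prod_chart :: "('m, 'v) chart \<Rightarrow> ('n, 'w) chart \<Rightarrow> ('m \<times> 'n, 'v \<times> 'w) chart" where
  "prod_chart \<kappa> \<rho> = (fst \<kappa> \<times> fst \<rho>, map_prod (snd \<kappa>) (snd \<rho>))"

definition prod_atlas ::
  "('m, 'v) chart set \<Rightarrow> ('n, 'w) chart set \<Rightarrow> ('m \<times> 'n, 'v \<times> 'w) chart set" where
  "prod_atlas A B = {prod_chart \<kappa> \<rho> | \<kappa> \<rho>. \<kappa> \<in> A \<and> \<rho> \<in> B}"

section \<open>Lie groups\<close>

record ('g, 'v) lie_group_data = "'g monoid" +
  lg_topology :: "'g topology"
  lg_atlas :: "('g, 'v) chart set"

definition lie_group :: "('g, 'v::euclidean_space) lie_group_data \<Rightarrow> bool" where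
  "lie_group G \<longleftrightarrow>
     group G \<and> topspace (lg_topology G) = carrier G \<and>
     smooth_manifold (lg_topology G) (lg_atlas G) \<and>
     smooth_map (prod_topology (lg_topology G) (lg_topology G)) (prod_atlas (lg_atlas G) (lg_atlas G))
       (lg_topology G) (lg_atlas G) (\<lambda>(g, h). g \<otimes>\<^bsub>G\<^esub> h) \<and>
     smooth_map (lg_topology G) (lg_atlas G) (lg_topology G) (lg_atlas G) (\<lambda>g. inv\<^bsub>G\<^esub> g)"

text \<open>
  Throughout, \<open>\<kappa>\<close> is a chart around the identity. It identifies the tangent space at the
  identity, i.e. the Lie algebra, with the model space \<open>'v\<close>; the dual of the Lie algebra
  is then the type of bounded (here: all) linear functionals on \<open>'v\<close>.
\<close>

text \<open>The tangent map at \<open>e\<close> of \<open>h \<mapsto> g\<inverse> h g\<close> (note the position of the inverse).\<close>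

definition Ad :: "('g, 'v::real_normed_vector) lie_group_data \<Rightarrow> ('g, 'v) chart \<Rightarrow> 'g \<Rightarrow> 'v \<Rightarrow> 'v" where
  "Ad G \<kappa> g =
     frechet_derivative (snd \<kappa> \<circ> (\<lambda>h. inv\<^bsub>G\<^esub> g \<otimes>\<^bsub>G\<^esub> h \<otimes>\<^bsub>G\<^esub> g) \<circ> chart_inv \<kappa>) (at (snd \<kappa> \<one>\<^bsub>G\<^esub>))"

definition Ad_star ::
  "('g, 'v::real_normed_vector) lie_group_data \<Rightarrow> ('g, 'v) chart \<Rightarrow> 'g \<Rightarrow>
   ('v \<Rightarrow>\<^sub>L real) \<Rightarrow> ('v \<Rightarrow>\<^sub>L real)" where
  "Ad_star G \<kappa> g \<mu> = Blinfun (\<lambda>\<xi>. blinfun_apply \<mu> (Ad G \<kappa> (inv\<^bsub>G\<^esub> g) \<xi>))"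

definition one_parameter_subgroup ::
  "('g, 'v::real_normed_vector) lie_group_data \<Rightarrow> ('g, 'v) chart \<Rightarrow> 'v \<Rightarrow> (real \<Rightarrow> 'g) \<Rightarrow> bool" where
  "one_parameter_subgroup G \<kappa> \<xi> c \<longleftrightarrow>
     continuous_map euclidean (lg_topology G) c \<and>
     (\<forall>s t. c (s + t) = c s \<otimes>\<^bsub>G\<^esub> c t) \<and>
     ((\<lambda>t. snd \<kappa> (c t)) has_vector_derivative \<xi>) (at 0)"

definition lie_exp :: "('g, 'v::real_normed_vector) lie_group_data \<Rightarrow> ('g, 'v) chart \<Rightarrow> 'v \<Rightarrow> 'g" where
  "lie_exp G \<kappa> \<xi> = (THE c. one_parameter_subgroup G \<kappa> \<xi> c) 1"

definition lie_bracket ::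
  "('g, 'v::real_normed_vector) lie_group_data \<Rightarrow> ('g, 'v) chart \<Rightarrow> 'v \<Rightarrow> 'v \<Rightarrow> 'v" where
  "lie_bracket G \<kappa> \<xi> \<eta> = vector_derivative (\<lambda>t. Ad G \<kappa> (lie_exp G \<kappa> (t *\<^sub>R \<xi>)) \<eta>) (at 0)"

definition ad_star ::
  "('g, 'v::real_normed_vector) lie_group_data \<Rightarrow> ('g, 'v) chart \<Rightarrow> 'v \<Rightarrow>
   ('v \<Rightarrow>\<^sub>L real) \<Rightarrow> ('v \<Rightarrow>\<^sub>L real)" where
  "ad_star G \<kappa> \<xi> \<mu> = Blinfun (\<lambda>\<eta>. blinfun_apply \<mu> (lie_bracket G \<kappa> \<xi> \<eta>))"

section \<open>The semidirect product of a Lie group with the dual of its Lie algebra\<close>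

definition semidirect ::
  "('g, 'v::real_normed_vector) lie_group_data \<Rightarrow> ('g, 'v) chart \<Rightarrow>
   ('g \<times> ('v \<Rightarrow>\<^sub>L real), 'v \<times> ('v \<Rightarrow>\<^sub>L real)) lie_group_data" where
  "semidirect G \<kappa> =
     \<lparr>carrier = carrier G \<times> UNIV,
      mult = (\<lambda>(g, \<mu>) (h, \<nu>). (g \<otimes>\<^bsub>G\<^esub> h, \<mu> + Ad_star G \<kappa> (inv\<^bsub>G\<^esub> g) \<nu>)),
      one = (\<one>\<^bsub>G\<^esub>, 0),
      lg_topology = prod_topology (lg_topology G) euclidean,
      lg_atlas = prod_atlas (lg_atlas G) {(UNIV, id)}\<rparr>"

definition semidirect_chart ::
  "('g, 'v::real_normed_vector) chart \<Rightarrow>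
   ('g \<times> ('v \<Rightarrow>\<^sub>L real), 'v \<times> ('v \<Rightarrow>\<^sub>L real)) chart" where
  "semidirect_chart \<kappa> = prod_chart \<kappa> (UNIV, id)"

section \<open>Lie--Poisson brackets and Hamiltonian vector fields\<close>

text \<open>
  A bilinear map \<open>B\<close> presents \<open>'k\<close> as the space of linear functionals on \<open>'d\<close>. The functional
  derivative of \<open>F\<close> at \<open>\<alpha>\<close> is the element of \<open>'k\<close> representing the differential of \<open>F\<close> at \<open>\<alpha>\<close>.
\<close>

definition functional_deriv ::
  "('d::real_normed_vector \<Rightarrow> 'k \<Rightarrow> real) \<Rightarrow> ('d \<Rightarrow> real) \<Rightarrow> 'd \<Rightarrow> 'k" where
  "functional_deriv B F \<alpha> = (THE k. \<forall>\<beta>. frechet_derivative F (at \<alpha>) \<beta> = B \<beta> k)"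

definition lie_poisson_bracket ::
  "('d::real_normed_vector \<Rightarrow> 'k \<Rightarrow> real) \<Rightarrow> ('k \<Rightarrow> 'k \<Rightarrow> 'k) \<Rightarrow>
   ('d \<Rightarrow> real) \<Rightarrow> ('d \<Rightarrow> real) \<Rightarrow> 'd \<Rightarrow> real" where
  "lie_poisson_bracket B brk F H \<alpha> = B \<alpha> (brk (functional_deriv B F \<alpha>) (functional_deriv B H \<alpha>))"

definition hamiltonian_vector_field ::
  "(('d::real_normed_vector \<Rightarrow> real) \<Rightarrow> ('d \<Rightarrow> real) \<Rightarrow> 'd \<Rightarrow> real) \<Rightarrow>
   ('d \<Rightarrow> real) \<Rightarrow> ('d \<Rightarrow> 'd) \<Rightarrow> bool" where
  "hamiltonian_vector_field P H X \<longleftrightarrow>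
     smooth_on UNIV X \<and>
     (\<forall>F. smooth_on UNIV F \<longrightarrow> (\<forall>\<alpha>. P F H \<alpha> = - frechet_derivative F (at \<alpha>) (X \<alpha>)))"

text \<open>
  The pairing of \<open>(\<nu>, \<xi>)\<close> with \<open>(\<eta>, \<mu>)\<close> that presents the space of pairs \<open>(\<nu>, \<xi>)\<close> as the dual
  of the Lie algebra of the semidirect product.
\<close>

definition semidirect_pairing ::
  "('v::real_normed_vector \<Rightarrow>\<^sub>L real) \<times> 'v \<Rightarrow> 'v \<times> ('v \<Rightarrow>\<^sub>L real) \<Rightarrow> real" where
  "semidirect_pairing = (\<lambda>(\<nu>, \<xi>) (\<eta>, \<mu>). blinfun_apply \<nu> \<eta> + blinfun_apply \<mu> \<xi>)"

definition semidirect_poisson ::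
  "('g, 'v::real_normed_vector) lie_group_data \<Rightarrow> ('g, 'v) chart \<Rightarrow>
   (('v \<Rightarrow>\<^sub>L real) \<times> 'v \<Rightarrow> real) \<Rightarrow> (('v \<Rightarrow>\<^sub>L real) \<times> 'v \<Rightarrow> real) \<Rightarrow>
   ('v \<Rightarrow>\<^sub>L real) \<times> 'v \<Rightarrow> real" where
  "semidirect_poisson G \<kappa> =
     lie_poisson_bracket semidirect_pairing (lie_bracket (semidirect G \<kappa>) (semidirect_chart \<kappa>))"

definition deriv_nu ::
  "(('v::real_normed_vector \<Rightarrow>\<^sub>L real) \<times> 'v \<Rightarrow> real) \<Rightarrow> ('v \<Rightarrow>\<^sub>L real) \<Rightarrow> 'v \<Rightarrow> 'v" where
  "deriv_nu F \<nu> \<xi> = functional_deriv blinfun_apply (\<lambda>\<nu>'. F (\<nu>', \<xi>)) \<nu>"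

definition deriv_xi ::
  "(('v::real_normed_vector \<Rightarrow>\<^sub>L real) \<times> 'v \<Rightarrow> real) \<Rightarrow> ('v \<Rightarrow>\<^sub>L real) \<Rightarrow> 'v \<Rightarrow> ('v \<Rightarrow>\<^sub>L real)" where
  "deriv_xi F \<nu> \<xi> = functional_deriv (\<lambda>\<xi>' \<mu>. blinfun_apply \<mu> \<xi>') (\<lambda>\<xi>'. F (\<nu>, \<xi>')) \<xi>"

end

theory Submission
  imports Defs
begin

text \<open>
  In the chart around the identity, a one-parameter subgroup solves the ordinary differential
  equation of a right invariant vector field; Picard iteration gives a local solution, which is
  additive by uniqueness and extends to the real line by \<open>c(t) = c(t/n)\<^sup>n\<close>. Hence the
  exponential map exists and the bracket is the derivative of \<open>Ad\<close> at the identity. It is bilinear,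
  and it is alternating because \<open>Ad\<close> fixes \<open>\<xi>\<close> along \<open>exp(t\<xi>)\<close>.

  A one-parameter subgroup of the semidirect product is a pair \<open>(c, n)\<close> with \<open>c\<close> one of \<open>G\<close> and
  \<open>n' = \<mu> \<circ> Ad\<^bsub>c(t)\<^esub>\<close>, \<open>n(0) = 0\<close>. Differentiating
  \<open>Ad\<^bsub>(g, \<mu>)\<^esub> (\<eta>, \<rho>) = (Ad\<^bsub>g\<^esub> \<eta>, (\<rho> + ad\<^sup>*\<^bsub>\<eta>\<^esub> \<mu>) \<circ> Ad\<^bsub>g\<inverse>\<^esub>)\<close> along it gives the
  bracket of the semidirect product, and testing against linear functions determines the
  Hamiltonian vector field.
\<close>

section \<open>Smooth maps on open sets\<close>

text \<open>The shape of the proof is dictated by \<open>lie_exp\<close>, a definite description: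
  nothing can be said about a bracket before one-parameter subgroups are known to exist and to be
  unique, for \<open>G\<close> and again for the semidirect product. For the latter no second
  differential equation has to be solved: its second component is the integral of a curve already
  known, so existence and uniqueness reduce to antiderivatives. A one-parameter subgroup is assumed
  differentiable only at 0; the homomorphism law carries the derivative to other times, and
  differentiating c(s + t) = c(s) c(t) in the left factor is what makes the field right invariant.
  The sign conventions hang on one reversal: as \<open>Ad\<close> at g comes from h \<mapsto>
  g\<inverse> h g, it reverses products, so \<nu> \<mapsto> \<nu> \<circ> Ad preserves them and is a
  left action. The bracket is a mixed second derivative of conjugation, one derivative in each group
  variable, so conjugation has to be smooth in both variables jointly.\<close>

lemma k_smooth_on_differentiable:
  assumes "k_smooth_on (Suc k) S f" "x \<in> S"
  shows "(f has_derivative frechet_derivative f (at x)) (at x)"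
  using assms by (simp add: frechet_derivative_works)

lemma k_smooth_on_SucD: "k_smooth_on (Suc k) S f \<Longrightarrow> k_smooth_on k S f"
proof (induction k arbitrary: f)
  case 0
  then show ?case
    by (auto intro!: continuous_at_imp_continuous_on differentiable_imp_continuous_within)
next
  case (Suc k)
  then show ?case by (subst k_smooth_on.simps(2)) (auto simp del: k_smooth_on.simps(2) simp: k_smooth_on.simps(2)[of "Suc k"])
qed

lemma smooth_on_imp_k_smooth_on: "smooth_on S f \<Longrightarrow> k_smooth_on k S f"
  by (simp add: smooth_on_def)

lemma k_smooth_on_subset:
  "k_smooth_on k S f \<Longrightarrow> T \<subseteq> S \<Longrightarrow> k_smooth_on k T f"
  by (induction k arbitrary: f) (auto intro: continuous_on_subset)

text \<open>Derivatives are taken in the whole space, so equality on \<open>S\<close> passes to them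
  because \<open>S\<close> is open.\<close>

lemma k_smooth_on_cong:
  assumes "open S"
  shows "(\<And>x. x \<in> S \<Longrightarrow> f x = g x) \<Longrightarrow> k_smooth_on k S f \<Longrightarrow> k_smooth_on k S g"
proof (induction k arbitrary: f g)
  case 0
  then show ?case by (simp cong: continuous_on_cong)
next
  case (Suc k)
  have d: "(g has_derivative frechet_derivative f (at x)) (at x)" if "x \<in> S" for x
    using has_derivative_transform_within_open[OF k_smooth_on_differentiable[OF Suc.prems(2) that] assms that]
      Suc.prems(1) by blast
  have e: "frechet_derivative f (at x) v = frechet_derivative g (at x) v" if "x \<in> S" for x v
    using frechet_derivative_at[OF d[OF that]] by simp
  show ?case
    using d Suc.prems(2) by (auto simp: differentiable_def intro: Suc.IH[OF e])
qed

text \<open>The class is defined through \<open>frechet_derivative\<close>; this rule lets each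
  closure proof below supply its own derivative formula \<open>f'\<close> instead.\<close>

lemma k_smooth_on_SucI:
  assumes "open S" "\<And>x. x \<in> S \<Longrightarrow> (f has_derivative f' x) (at x)"
    and "\<And>v. k_smooth_on k S (\<lambda>x. f' x v)"
  shows "k_smooth_on (Suc k) S f"
proof -
  have e: "f' x v = frechet_derivative f (at x) v" if "x \<in> S" for x v
    using frechet_derivative_at[OF assms(2)[OF that]] by simp
  show ?thesis
    using assms by (auto simp: differentiable_def intro: k_smooth_on_cong[OF assms(1) e])
qed

lemma k_smooth_on_const: "k_smooth_on k S (\<lambda>x. c)"
proof (induction k arbitrary: c)
  case 0
  then show ?case by simp
next
  case (Suc k)
  show ?case using Suc[of 0] by (simp)
qed

lemma k_smooth_on_bounded_linear_id:
  assumes "bounded_linear L"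
  shows "k_smooth_on k S L"
proof (cases k)
  case 0
  then show ?thesis by (simp add: assms linear_continuous_on)
next
  case (Suc n)
  have d: "(L has_derivative L) (at x)" for x
    by (simp add: assms bounded_linear_imp_has_derivative)
  then have "frechet_derivative L (at x) = L" for x
    by (metis frechet_derivative_at)
  with d show ?thesis using Suc k_smooth_on_const by (auto simp: differentiable_def)
qed

lemma k_smooth_on_bounded_linear:
  assumes "bounded_linear L" "open S"
  shows "k_smooth_on k S f \<Longrightarrow> k_smooth_on k S (\<lambda>x. L (f x))"
proof (induction k arbitrary: f)
  case 0
  then show ?case by (simp add: assms bounded_linear.continuous_on)
next
  case (Suc k)
  show ?case
  proof (rule k_smooth_on_SucI[OF assms(2)])
    show "((\<lambda>x. L (f x)) has_derivative (\<lambda>v. L (frechet_derivative f (at x) v))) (at x)" if "x \<in> S" for x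
      using bounded_linear.has_derivative[OF assms(1) k_smooth_on_differentiable[OF Suc.prems that]] .
  qed (use Suc in auto)
qed

lemma k_smooth_on_add:
  assumes "open S"
  shows "k_smooth_on k S f \<Longrightarrow> k_smooth_on k S g \<Longrightarrow> k_smooth_on k S (\<lambda>x. f x + g x)"
proof (induction k arbitrary: f g)
  case 0
  then show ?case by (simp add: continuous_on_add)
next
  case (Suc k)
  show ?case
  proof (rule k_smooth_on_SucI[OF assms])
    show "((\<lambda>x. f x + g x) has_derivative
        (\<lambda>v. frechet_derivative f (at x) v + frechet_derivative g (at x) v)) (at x)" if "x \<in> S" for x
      using k_smooth_on_differentiable Suc.prems that by (intro has_derivative_add)
  qed (use Suc in auto)
qed

lemma k_smooth_on_diff:
  assumes "open S" "k_smooth_on k S f" "k_smooth_on k S g"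
  shows "k_smooth_on k S (\<lambda>x. f x - g x)"
  using k_smooth_on_add[OF assms(1,2) k_smooth_on_bounded_linear[OF bounded_linear_minus[OF bounded_linear_ident] assms(1,3)]]
  by simp

lemma k_smooth_on_sum:
  assumes "open S" "\<And>i. i \<in> I \<Longrightarrow> k_smooth_on k S (f i)"
  shows "k_smooth_on k S (\<lambda>x. \<Sum>i\<in>I. f i x)"
  using assms(2)
proof (induction I rule: infinite_finite_induct)
  case (insert a A)
  then show ?case using k_smooth_on_add[OF assms(1), of k "f a" "\<lambda>x. \<Sum>i\<in>A. f i x"] by simp
qed (auto simp: k_smooth_on_const)

lemma k_smooth_on_Pair:
  assumes "open S" "k_smooth_on k S f" "k_smooth_on k S g"
  shows "k_smooth_on k S (\<lambda>x. (f x, g x))"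
proof -
  have 1: "bounded_linear (\<lambda>x. (x, 0))" "bounded_linear (\<lambda>x. (0, x))"
    by (intro bounded_linear_Pair bounded_linear_ident bounded_linear_zero)+
  show ?thesis
    using k_smooth_on_add[OF assms(1) k_smooth_on_bounded_linear[OF 1(1) assms(1,2)]
        k_smooth_on_bounded_linear[OF 1(2) assms(1,3)]] by simp
qed

lemma k_smooth_on_bounded_bilinear:
  assumes "bounded_bilinear B" "open S"
  shows "k_smooth_on k S f \<Longrightarrow> k_smooth_on k S g \<Longrightarrow> k_smooth_on k S (\<lambda>x. B (f x) (g x))"
proof (induction k arbitrary: f g)
  case 0
  then show ?case by (simp add: assms bounded_bilinear.continuous_on)
next
  case (Suc k)
  show ?case
  proof (rule k_smooth_on_SucI[OF assms(2)])
    show "((\<lambda>x. B (f x) (g x)) has_derivative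
        (\<lambda>v. B (f x) (frechet_derivative g (at x) v) + B (frechet_derivative f (at x) v) (g x))) (at x)"
      if "x \<in> S" for x
      by (rule bounded_bilinear.FDERIV[OF assms(1)] k_smooth_on_differentiable Suc.prems that)+
    show "k_smooth_on k S (\<lambda>x. B (f x) (frechet_derivative g (at x) v) + B (frechet_derivative f (at x) v) (g x))" for v
      using Suc.prems Suc.prems[THEN k_smooth_on_SucD] by (intro k_smooth_on_add Suc.IH assms) auto
  qed
qed

text \<open>The chain rule gives f'(g x) (g'(x) v), a derivative of f in a direction that moves with
  x. Expanding this direction in the basis of the middle space leaves scalar factors times
  derivatives of f in fixed directions b, evaluated at g x; the induction hypothesis applies to
  those with the same \<open>g\<close>.\<close>

lemma k_smooth_on_compose:
  fixes f :: "'b::euclidean_space \<Rightarrow> 'c::real_normed_vector"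
  assumes "open S" "open T" "g ` S \<subseteq> T"
  shows "k_smooth_on k T f \<Longrightarrow> k_smooth_on k S g \<Longrightarrow> k_smooth_on k S (\<lambda>x. f (g x))"
proof (induction k arbitrary: f)
  case 0
  then show ?case using assms(3) by (auto intro: continuous_on_compose2)
next
  case (Suc k)
  let ?f = "\<lambda>x. frechet_derivative f (at x)" and ?g = "\<lambda>x. frechet_derivative g (at x)"
  show ?case
  proof (rule k_smooth_on_SucI[OF assms(1)])
    fix x assume x: "x \<in> S"
    have f': "(f has_derivative ?f (g x)) (at (g x))"
      using k_smooth_on_differentiable Suc.prems(1) x assms(3) by blast
    interpret f': bounded_linear "?f (g x)" using f' by (rule has_derivative_bounded_linear)
    have "?f (g x) w = (\<Sum>b\<in>Basis. (w \<bullet> b) *\<^sub>R ?f (g x) b)" for w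
    proof -
      have "?f (g x) w = ?f (g x) (\<Sum>b\<in>Basis. (w \<bullet> b) *\<^sub>R b)" by (simp add: euclidean_representation)
      then show ?thesis by (simp add: f'.sum f'.scaleR)
    qed
    then have eq: "(\<lambda>v. ?f (g x) (?g x v)) = (\<lambda>v. \<Sum>b\<in>Basis. (?g x v \<bullet> b) *\<^sub>R ?f (g x) b)"
      by (intro ext)
    show "((\<lambda>x. f (g x)) has_derivative (\<lambda>v. \<Sum>b\<in>Basis. (?g x v \<bullet> b) *\<^sub>R ?f (g x) b)) (at x)"
      using has_derivative_compose[OF k_smooth_on_differentiable[OF Suc.prems(2) x] f'] unfolding eq .
  next
    show "k_smooth_on k S (\<lambda>x. \<Sum>b\<in>Basis. (?g x v \<bullet> b) *\<^sub>R ?f (g x) b)" for v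
    proof (rule k_smooth_on_sum[OF assms(1)])
      fix b :: 'b
      have "k_smooth_on k S (\<lambda>x. ?g x v \<bullet> b)"
        using Suc.prems by (auto intro: k_smooth_on_bounded_linear[OF bounded_linear_inner_left assms(1)])
      moreover have "k_smooth_on k S (\<lambda>x. ?f (g x) b)"
        using Suc.prems(1) k_smooth_on_SucD[OF Suc.prems(2)] by (intro Suc.IH) auto
      ultimately show "k_smooth_on k S (\<lambda>x. (?g x v \<bullet> b) *\<^sub>R ?f (g x) b)"
        by (rule k_smooth_on_bounded_bilinear[OF bounded_bilinear_scaleR assms(1)])
    qed
  qed
qed

text \<open>This is the mean value inequality on a ball, which is convex. The operator norm of the
  derivative is at most the sum \<open>h\<close> of its norms on basis vectors; \<open>h\<close> is
  continuous, so it stays below h x + 1 near \<open>x\<close>.\<close>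

lemma k_smooth_on_locally_lipschitz:
  fixes f :: "'a::euclidean_space \<Rightarrow> 'b::real_normed_vector"
  assumes "open S" "k_smooth_on (Suc 0) S f" "x \<in> S"
  obtains r L where "r > 0" "L \<ge> 0" "cball x r \<subseteq> S"
    "\<And>y z. y \<in> cball x r \<Longrightarrow> z \<in> cball x r \<Longrightarrow> norm (f y - f z) \<le> L * norm (y - z)"
proof -
  let ?f = "\<lambda>x. frechet_derivative f (at x)"
  define h where "h y = (\<Sum>b\<in>Basis. norm (?f y b))" for y
  have "continuous_on S h"
    unfolding h_def using assms(2) by (auto intro!: continuous_on_sum continuous_on_norm)
  then have "isCont h x" using assms by (simp add: continuous_on_eq_continuous_at)
  then obtain d where d: "d > 0" "\<And>y. dist y x < d \<Longrightarrow> dist (h y) (h x) < 1"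
    unfolding continuous_at_eps_delta by (metis zero_less_one)
  obtain e where e: "e > 0" "cball x e \<subseteq> S" using assms(1,3) open_contains_cball by blast
  define r where "r = min e (d/2)"
  define L where "L = h x + 1"
  have r: "r > 0" "cball x r \<subseteq> S" using d e by (auto simp: r_def)
  have h0: "h y \<ge> 0" for y by (simp add: h_def sum_nonneg)
  have "norm (f y - f z) \<le> L * norm (y - z)" if "y \<in> cball x r" "z \<in> cball x r" for y z
  proof (rule differentiable_bound[OF convex_cball _ _ that])
    fix w assume w: "w \<in> cball x r"
    have D: "(f has_derivative ?f w) (at w)" using k_smooth_on_differentiable assms(2) w r by blast
    then show "(f has_derivative ?f w) (at w within cball x r)" by (rule has_derivative_at_withinI)
    interpret f': bounded_linear "?f w" using D by (rule has_derivative_bounded_linear)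
    have "dist w x < d" using w d by (auto simp: r_def dist_commute)
    then have "h w \<le> L" using d(2)[of w] by (auto simp: L_def dist_real_def)
    moreover have "onorm (?f w) \<le> h w"
    proof (rule onorm_bound)
      fix u
      have "norm (?f w u) = norm (?f w (\<Sum>b\<in>Basis. (u \<bullet> b) *\<^sub>R b))" by (simp add: euclidean_representation)
      also have "\<dots> = norm (\<Sum>b\<in>Basis. (u \<bullet> b) *\<^sub>R ?f w b)" by (simp add: f'.sum f'.scaleR)
      also have "\<dots> \<le> (\<Sum>b\<in>Basis. norm (?f w b) * norm u)"
        by (intro sum_norm_le) (auto simp: Basis_le_norm mult.commute mult_right_mono)
      finally show "norm (?f w u) \<le> h w * norm u" by (simp add: h_def sum_distrib_right)
    qed (rule h0)
    ultimately show "onorm (?f w) \<le> L" by linarith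
  qed
  moreover have "L \<ge> 0" using h0[of x] by (simp add: L_def)
  ultimately show ?thesis using that r by blast
qed

section \<open>Autonomous ordinary differential equations\<close>

text \<open>Gronwall's argument: for w = u - v, Cauchy-Schwarz and the Lipschitz bound give (w
  \<bullet> w)' \<le> 2 L (w \<bullet> w), so exp(-2 L t) (w \<bullet> w) cannot increase from its
  initial value 0.\<close>

lemma ode_unique_right:
  fixes u v :: "real \<Rightarrow> 'a::real_inner"
  assumes "0 \<le> T"
    and u: "\<And>t. t \<in> {0..T} \<Longrightarrow> (u has_vector_derivative V (u t)) (at t)" "\<And>t. t \<in> {0..T} \<Longrightarrow> u t \<in> S"
    and v: "\<And>t. t \<in> {0..T} \<Longrightarrow> (v has_vector_derivative V (v t)) (at t)" "\<And>t. t \<in> {0..T} \<Longrightarrow> v t \<in> S"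
    and lip: "\<And>x y. x \<in> S \<Longrightarrow> y \<in> S \<Longrightarrow> norm (V x - V y) \<le> L * norm (x - y)"
    and "u 0 = v 0"
  shows "u T = v T"
proof -
  define w where "w t = u t - v t" for t
  define f where "f t = exp (- 2 * L * t) * (w t \<bullet> w t)" for t
  have "f T \<le> f 0"
  proof (rule DERIV_nonpos_imp_nonincreasing[OF assms(1)])
    fix t assume "0 \<le> t" "t \<le> T"
    then have t: "t \<in> {0..T}" by simp
    define w' where "w' = V (u t) - V (v t)"
    have w: "(w has_vector_derivative w') (at t)"
      unfolding w_def[abs_def] w'_def using u(1)[OF t] v(1)[OF t] by (rule has_vector_derivative_diff)
    have "((\<lambda>t. w t \<bullet> w t) has_vector_derivative w t \<bullet> w' + w' \<bullet> w t) (at t)"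
      using bounded_bilinear.has_vector_derivative[OF bounded_bilinear_inner w w] .
    then have "((\<lambda>t. w t \<bullet> w t) has_real_derivative w t \<bullet> w' + w' \<bullet> w t) (at t)"
      by (simp add: has_real_derivative_iff_has_vector_derivative)
    then have "(f has_real_derivative exp (- 2 * L * t) * (w t \<bullet> w' + w' \<bullet> w t)
        + (exp (- 2 * L * t) * (- 2 * L)) * (w t \<bullet> w t)) (at t)"
      unfolding f_def[abs_def] by (auto intro!: derivative_eq_intros)
    moreover have "w t \<bullet> w' \<le> norm (w t) * norm w'" by (rule norm_cauchy_schwarz)
    moreover have "norm (w t) * norm w' \<le> norm (w t) * (L * norm (w t))"
      using lip[OF u(2)[OF t] v(2)[OF t]] by (intro mult_left_mono) (auto simp: w_def w'_def)
    ultimately have "w t \<bullet> w' \<le> L * (w t \<bullet> w t)"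
      by (simp add: dot_square_norm power2_eq_square mult_ac)
    then have "exp (- 2 * L * t) * (2 * (w t \<bullet> w' - L * (w t \<bullet> w t))) \<le> 0"
      by (intro mult_nonneg_nonpos) auto
    then have "exp (- 2 * L * t) * (w t \<bullet> w' + w' \<bullet> w t)
        + (exp (- 2 * L * t) * (- 2 * L)) * (w t \<bullet> w t) \<le> 0"
      by (simp add: algebra_simps inner_commute)
    with \<open>(f has_real_derivative _) (at t)\<close> show "\<exists>y. DERIV f t :> y \<and> y \<le> 0" by blast
  qed
  then have "exp (- 2 * L * T) * (w T \<bullet> w T) \<le> 0" using assms(7) by (simp add: f_def w_def)
  then have "w T \<bullet> w T \<le> 0" by (simp add: mult_le_0_iff)
  then have "w T = 0" by (metis inner_eq_zero_iff inner_ge_zero order_antisym)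
  then show ?thesis by (simp add: w_def)
qed

lemma ode_unique:
  fixes u v :: "real \<Rightarrow> 'a::real_inner"
  assumes u: "\<And>t. \<bar>t\<bar> < r \<Longrightarrow> (u has_vector_derivative V (u t)) (at t)" "\<And>t. \<bar>t\<bar> < r \<Longrightarrow> u t \<in> S"
    and v: "\<And>t. \<bar>t\<bar> < r \<Longrightarrow> (v has_vector_derivative V (v t)) (at t)" "\<And>t. \<bar>t\<bar> < r \<Longrightarrow> v t \<in> S"
    and lip: "\<And>x y. x \<in> S \<Longrightarrow> y \<in> S \<Longrightarrow> norm (V x - V y) \<le> L * norm (x - y)"
    and eq: "u 0 = v 0" and t: "\<bar>t\<bar> < r"
  shows "u t = v t"
proof (cases "t \<ge> 0")
  case True
  show ?thesis
    by (rule ode_unique_right[where T = t and u = u and v = v and V = V and S = S and L = L])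
      (use True assms in auto)
next
  case False
  \<comment> \<open>Negative times are reached by reversing time, which replaces \<open>V\<close> by
    its negative and keeps the Lipschitz constant.\<close>
  have m: "((\<lambda>s. w (- s)) has_vector_derivative - V (w (- s))) (at s)"
    if "(w has_vector_derivative V (w (- s))) (at (- s))" for w :: "real \<Rightarrow> 'a" and s
    using vector_diff_chain_at[of uminus "-1" s w "V (w (- s))"] that
      has_vector_derivative_minus[OF has_vector_derivative_id] by (simp add: o_def)
  have "u (- (- t)) = v (- (- t))"
  proof (rule ode_unique_right[where T = "- t" and u = "\<lambda>s. u (- s)" and v = "\<lambda>s. v (- s)"
        and V = "\<lambda>x. - V x" and S = S and L = L])
    show "norm (- V x - - V y) \<le> L * norm (x - y)" if "x \<in> S" "y \<in> S" for x y
      using lip[OF that] by (simp add: norm_minus_commute)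
  qed (use False t eq in \<open>auto intro!: m u v\<close>)
  then show ?thesis by simp
qed

text \<open>The difference stands for the oriented integral from 0 to \<open>a\<close>, whatever the
  sign of \<open>a\<close>. The factor 3 r bounds the two interval lengths added together, at most 2
  r and r.\<close>

lemma norm_integral_diff_bound:
  fixes f :: "real \<Rightarrow> 'a::banach"
  assumes "continuous_on UNIV f" "\<And>s. norm (f s) \<le> B" "a \<in> {-r..r}" "0 \<le> r" "0 \<le> B"
  shows "norm (integral {-r..a} f - integral {-r..0} f) \<le> 3 * r * B"
proof -
  have c: "continuous_on {x..y} f" for x y using assms(1) by (rule continuous_on_subset) simp
  have "norm (integral {-r..a} f) \<le> B * (a - - r)" "norm (integral {-r..0} f) \<le> B * (0 - - r)"
    using assms by (intro integral_bound c; auto)+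
  then have "norm (integral {-r..a} f - integral {-r..0} f) \<le> B * (a - - r) + B * (0 - - r)"
    by (meson add_mono norm_triangle_ineq4 order_trans)
  also have "\<dots> \<le> B * (2 * r) + B * r"
    using assms by (intro add_mono mult_left_mono) auto
  finally show ?thesis by (simp add: mult_ac)
qed

text \<open>The contraction principle is applied to curves on the whole real line, in the complete
  space of bounded continuous functions. Two modifications permit this, projecting space to the ball
  and clamping time to {-r..r}; neither is visible to the fixed point for \<bar>t\<bar> < r.\<close>

lemma picard_lindelof:
  fixes V :: "'a::euclidean_space \<Rightarrow> 'a"
  assumes "\<rho> > 0" "L \<ge> 0"
    and lip: "\<And>x y. x \<in> cball x0 \<rho> \<Longrightarrow> y \<in> cball x0 \<rho> \<Longrightarrow> norm (V x - V y) \<le> L * norm (x - y)"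
  obtains r y where "r > 0" "y 0 = x0" "\<And>t. \<bar>t\<bar> < r \<Longrightarrow> y t \<in> cball x0 \<rho>"
    "\<And>t. \<bar>t\<bar> < r \<Longrightarrow> (y has_vector_derivative V (y t)) (at t)"
proof -
  \<comment> \<open>Nearest-point projection onto the ball does not increase distances, so
    \<open>W\<close> extends \<open>V\<close> from the ball to a field with the same Lipschitz
    constant everywhere, bounded by the \<open>M\<close> below.\<close>
  define P where "P = closest_point (cball x0 \<rho>)"
  define W where "W x = V (P x)" for x
  have P: "P x \<in> cball x0 \<rho>" for x
    unfolding P_def using assms(1) by (intro closest_point_in_set) auto
  have Pid: "P x = x" if "x \<in> cball x0 \<rho>" for x
    unfolding P_def using that by (rule closest_point_self)
  have "dist (P x) (P y) \<le> dist x y" for x y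
    unfolding P_def using assms(1) by (intro closest_point_lipschitz) auto
  then have "L * norm (P x - P y) \<le> L * norm (x - y)" for x y
    using assms(2) by (intro mult_left_mono) (auto simp: dist_norm)
  then have W: "norm (W x - W y) \<le> L * norm (x - y)" for x y
    unfolding W_def using lip[OF P P] order_trans by blast
  have contW: "continuous_on UNIV W"
    by (rule lipschitz_on_continuous_on[of L]) (use W assms(2) in \<open>auto simp: lipschitz_on_def dist_norm\<close>)
  define M where "M = norm (V x0) + L * \<rho>"
  have M0: "M \<ge> 0" using assms by (simp add: M_def)
  have M: "norm (W x) \<le> M" for x
  proof -
    have "norm (V (P x) - V x0) \<le> L * norm (P x - x0)" using assms(1) by (intro lip P) auto
    also have "\<dots> \<le> L * \<rho>" using P[of x] assms(2) by (intro mult_left_mono) (auto simp: dist_norm norm_minus_commute)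
    finally show ?thesis
      unfolding W_def M_def using norm_triangle_sub[of "V (P x)" "V x0"] by linarith
  qed
  \<comment> \<open>The first term keeps the images of the Picard operator within \<rho> of
    \<open>x0\<close>, the second makes the operator contract by 1/2. The 3 comes from
    \<open>norm_integral_diff_bound\<close>; the added 1 avoids division by zero.\<close>
  define r where "r = min (\<rho> / (3 * (M + 1))) (1 / (6 * (L + 1)))"
  have r: "r > 0" using assms M0 by (simp add: r_def)
  have rM: "3 * r * M \<le> \<rho>"
  proof -
    have "r \<le> \<rho> / (3 * (M + 1))" by (simp add: r_def)
    then have "r * (3 * (M + 1)) \<le> \<rho>" using M0 by (simp add: pos_le_divide_eq)
    then show ?thesis using r by (simp add: algebra_simps)
  qed
  have rL: "3 * r * L \<le> 1 / 2"
  proof -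
    have "r \<le> 1 / (6 * (L + 1))" by (simp add: r_def)
    then have "r * (6 * (L + 1)) \<le> 1" using assms by (simp add: pos_le_divide_eq)
    then show ?thesis using r by (simp add: algebra_simps)
  qed
  define cl where "cl t = max (- r) (min r t)" for t
  have cl: "cl t \<in> {-r..r}" for t using r by (auto simp: cl_def)
  have contcl: "continuous_on UNIV cl" unfolding cl_def by (intro continuous_intros)
  define J where "J f a = integral {-r..a} f - integral {-r..0} f" for f :: "real \<Rightarrow> 'a" and a
  define T where "T y t = x0 + J (\<lambda>s. W (y s)) (cl t)" for y t
  have contWy: "continuous_on UNIV (\<lambda>s. W (apply_bcontfun y s))" for y :: "real \<Rightarrow>\<^sub>C 'a"
    by (rule continuous_on_compose2[OF contW]) auto
  have "T y \<in> bcontfun" for y :: "real \<Rightarrow>\<^sub>C 'a"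
  proof (rule bcontfun_normI)
    let ?f = "\<lambda>s. W (apply_bcontfun y s)"
    have "continuous_on {-r..r} (\<lambda>a. integral {-r..a} ?f)"
      by (intro indefinite_integral_continuous_1 integrable_continuous_real continuous_on_subset[OF contWy]) auto
    then have "continuous_on UNIV (\<lambda>t. integral {-r..cl t} ?f)"
      by (rule continuous_on_compose2[OF _ contcl]) (use cl in auto)
    then show "continuous_on UNIV (T y)"
      unfolding T_def[abs_def] J_def by (intro continuous_intros)
    show "norm (T y t) \<le> norm x0 + 3 * r * M" for t
      unfolding T_def J_def
      by (rule order_trans[OF norm_triangle_ineq])
        (use norm_integral_diff_bound[OF contWy[of y] M cl[of t] less_imp_le[OF r] M0] in simp)
  qed
  then have T: "apply_bcontfun (Bcontfun (T y)) = T y" for y :: "real \<Rightarrow>\<^sub>C 'a"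
    by (simp add: Bcontfun_inverse)
  have "\<exists>!y. Bcontfun (T (apply_bcontfun y)) = y"
  proof (rule banach_fix_type[of "1 / 2"], safe)
    fix y z :: "real \<Rightarrow>\<^sub>C 'a"
    let ?f = "\<lambda>s. W (apply_bcontfun y s)" and ?g = "\<lambda>s. W (apply_bcontfun z s)"
    show "dist (Bcontfun (T (apply_bcontfun y))) (Bcontfun (T (apply_bcontfun z))) \<le> 1 / 2 * dist y z"
    proof (rule dist_bound, unfold T)
      fix t
      have i: "?f integrable_on {a..b}" "?g integrable_on {a..b}" for a b
        by (intro integrable_continuous_real continuous_on_subset[OF contWy] subset_UNIV)+
      have "norm (?f s - ?g s) \<le> L * dist y z" for s
        using W[of "y s" "z s"] mult_left_mono[OF dist_bounded[of y s z] assms(2)] by (simp add: dist_norm)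
      then have "norm (J (\<lambda>s. ?f s - ?g s) (cl t)) \<le> 3 * r * (L * dist y z)"
        unfolding J_def using r assms(2) cl
        by (intro norm_integral_diff_bound continuous_on_diff contWy) auto
      also have "\<dots> \<le> 1 / 2 * dist y z"
        using mult_right_mono[OF rL zero_le_dist[of y z]] by (simp add: mult_ac)
      also have "J (\<lambda>s. ?f s - ?g s) (cl t) = T y t - T z t"
        unfolding T_def J_def by (simp add: integral_diff[OF i])
      finally show "dist (T y t) (T z t) \<le> 1 / 2 * dist y z" by (simp add: dist_norm)
    qed
  qed auto
  then obtain Y where "Bcontfun (T (apply_bcontfun Y)) = Y" by blast
  then have Y: "apply_bcontfun Y = T Y" using T[of Y] by simp
  define y where "y = apply_bcontfun Y"
  have y: "y t = x0 + J (\<lambda>s. W (y s)) (cl t)" for t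
    using Y by (metis T_def y_def)
  \<comment> \<open>The bound on \<open>W\<close> confines the fixed point to the ball, where the
    projection is the identity and \<open>W\<close> agrees with \<open>V\<close>.\<close>
  have cb: "y t \<in> cball x0 \<rho>" for t
  proof -
    have "norm (J (\<lambda>s. W (y s)) (cl t)) \<le> 3 * r * M"
      unfolding J_def y_def using norm_integral_diff_bound[OF contWy M cl less_imp_le[OF r] M0] .
    moreover have "dist x0 (y t) = norm (J (\<lambda>s. W (y s)) (cl t))"
      using y[of t] by (simp add: dist_norm)
    ultimately show ?thesis using rM by simp
  qed
  show ?thesis
  proof (rule that[of r y])
    show "y 0 = x0" using y[of 0] r by (simp add: J_def cl_def)
    show "(y has_vector_derivative V (y t)) (at t)" if "\<bar>t\<bar> < r" for t
    proof (rule has_vector_derivative_transform_within_open[of _ _ _ "{-r<..<r}"])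
      have "((\<lambda>u. integral {-r..u} (\<lambda>s. W (y s))) has_vector_derivative W (y t)) (at t within {-r..r})"
        unfolding y_def using that
        by (intro integral_has_vector_derivative continuous_on_subset[OF contWy]) auto
      then have "((\<lambda>u. integral {-r..u} (\<lambda>s. W (y s))) has_vector_derivative W (y t)) (at t)"
        using that at_within_Icc_at[of "-r" t r] by auto
      then have "((\<lambda>u. x0 + J (\<lambda>s. W (y s)) u) has_vector_derivative W (y t)) (at t)"
        unfolding J_def by (auto intro!: derivative_eq_intros)
      then show "((\<lambda>u. x0 + J (\<lambda>s. W (y s)) u) has_vector_derivative V (y t)) (at t)"
        by (simp add: W_def Pid[OF cb])
      show "x0 + J (\<lambda>s. W (y s)) u = y u" if "u \<in> {-r<..<r}" for u
        using y[of u] that by (simp add: cl_def)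
    qed (use that in auto)
  qed (use r cb in auto)
qed

section \<open>Lie groups in charts\<close>

lemma smooth_map_in_charts:
  assumes "smooth_map S A T B f" "\<kappa> \<in> A" "\<tau> \<in> B"
  shows "smooth_on (snd \<kappa> ` (fst \<kappa> \<inter> f -` fst \<tau>)) (snd \<tau> \<circ> f \<circ> chart_inv \<kappa>)"
  using assms by (cases \<kappa>; cases \<tau>) (auto simp: smooth_map_def)

lemma lie_group_group: "lie_group G \<Longrightarrow> group G"
  and lie_group_topspace: "lie_group G \<Longrightarrow> topspace (lg_topology G) = carrier G"
  by (simp_all add: lie_group_def)

lemma lie_group_chart_ex:
  assumes "lie_group G" "g \<in> carrier G"
  obtains \<kappa> where "\<kappa> \<in> lg_atlas G" "g \<in> fst \<kappa>"
proof -
  have "(\<Union>\<kappa>\<in>lg_atlas G. fst \<kappa>) = carrier G"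
    using assms(1) by (simp add: lie_group_def smooth_manifold_def)
  then show ?thesis using assms(2) that by blast
qed

lemma lie_group_continuous_mult:
  assumes "lie_group G"
  shows "continuous_map (prod_topology (lg_topology G) (lg_topology G)) (lg_topology G) (\<lambda>(g, h). g \<otimes>\<^bsub>G\<^esub> h)"
  using assms by (simp add: lie_group_def smooth_map_def)

lemma lie_group_continuous_mult2:
  assumes "lie_group G" "continuous_map X (lg_topology G) f" "continuous_map X (lg_topology G) g"
  shows "continuous_map X (lg_topology G) (\<lambda>x. f x \<otimes>\<^bsub>G\<^esub> g x)"
  using continuous_map_compose[OF continuous_map_pairedI[OF assms(2,3)] lie_group_continuous_mult[OF assms(1)]]
  by (simp add: o_def)

lemma lie_group_continuous_conj:
  assumes "lie_group G" "g \<in> carrier G" "h \<in> carrier G"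
  shows "continuous_map (lg_topology G) (lg_topology G) (\<lambda>x. g \<otimes>\<^bsub>G\<^esub> x \<otimes>\<^bsub>G\<^esub> h)"
  using assms by (intro lie_group_continuous_mult2) (simp_all add: lie_group_topspace continuous_map_id[unfolded id_def])

locale lie_chart =
  fixes G :: "('g, 'v::euclidean_space) lie_group_data" and \<kappa> :: "('g, 'v) chart"
  assumes lie: "lie_group G" and atlas: "\<kappa> \<in> lg_atlas G"
begin

lemma openin_dom: "openin (lg_topology G) (fst \<kappa>)"
  and open_range: "open (snd \<kappa> ` fst \<kappa>)"
  and homeo: "homeomorphic_map (subtopology (lg_topology G) (fst \<kappa>)) (top_of_set (snd \<kappa> ` fst \<kappa>)) (snd \<kappa>)"
proof -
  have "\<forall>(U, \<phi>)\<in>lg_atlas G. openin (lg_topology G) U \<and> open (\<phi> ` U) \<and>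
      homeomorphic_map (subtopology (lg_topology G) U) (top_of_set (\<phi> ` U)) \<phi>"
    using lie by (simp add: lie_group_def smooth_manifold_def)
  from bspec[OF this atlas]
  show "openin (lg_topology G) (fst \<kappa>)" "open (snd \<kappa> ` fst \<kappa>)"
    "homeomorphic_map (subtopology (lg_topology G) (fst \<kappa>)) (top_of_set (snd \<kappa> ` fst \<kappa>)) (snd \<kappa>)"
    by (simp_all add: case_prod_beta)
qed

lemma dom_carrier: "g \<in> fst \<kappa> \<Longrightarrow> g \<in> carrier G"
  using openin_subset[OF openin_dom] lie_group_topspace[OF lie] by auto

lemma dom_Int: "topspace (lg_topology G) \<inter> fst \<kappa> = fst \<kappa>"
  using openin_subset[OF openin_dom] by auto

lemma inj_chart: "inj_on (snd \<kappa>) (fst \<kappa>)"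
  using homeomorphic_imp_injective_map[OF homeo] dom_Int by (simp add: topspace_subtopology)

lemma inv_chart [simp]: "g \<in> fst \<kappa> \<Longrightarrow> chart_inv \<kappa> (snd \<kappa> g) = g"
  using inj_chart by (rule inv_into_f_f)

lemma chart_inv_mem: "x \<in> snd \<kappa> ` fst \<kappa> \<Longrightarrow> chart_inv \<kappa> x \<in> fst \<kappa>"
  by (rule inv_into_into)

lemma chart_of_inv: "x \<in> snd \<kappa> ` fst \<kappa> \<Longrightarrow> snd \<kappa> (chart_inv \<kappa> x) = x"
  by (rule f_inv_into_f)

lemma continuous_chart: "continuous_map (subtopology (lg_topology G) (fst \<kappa>)) euclidean (snd \<kappa>)"
  using homeomorphic_imp_continuous_map[OF homeo] by (simp add: continuous_map_in_subtopology)

lemma continuous_chart_inv: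
  "continuous_map (top_of_set (snd \<kappa> ` fst \<kappa>)) (lg_topology G) (chart_inv \<kappa>)"
proof -
  obtain g where g: "homeomorphic_maps (subtopology (lg_topology G) (fst \<kappa>)) (top_of_set (snd \<kappa> ` fst \<kappa>)) (snd \<kappa>) g"
    using homeo by (auto simp: homeomorphic_map_maps)
  have "continuous_map (top_of_set (snd \<kappa> ` fst \<kappa>)) (lg_topology G) g"
    using g by (simp add: homeomorphic_maps_def continuous_map_in_subtopology)
  moreover have "g x = chart_inv \<kappa> x" if x: "x \<in> snd \<kappa> ` fst \<kappa>" for x
  proof -
    have "g (snd \<kappa> (chart_inv \<kappa> x)) = chart_inv \<kappa> x"
      using g chart_inv_mem[OF x] dom_Int by (auto simp: homeomorphic_maps_def)
    then show ?thesis using chart_of_inv[OF x] by simp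
  qed
  ultimately show ?thesis by (rule continuous_map_eq) simp
qed

lemma openin_chart_preimage:
  assumes "open W"
  shows "openin (lg_topology G) {g \<in> fst \<kappa>. snd \<kappa> g \<in> W}"
proof -
  have "openin (subtopology (lg_topology G) (fst \<kappa>)) {g \<in> fst \<kappa>. snd \<kappa> g \<in> W}"
    using openin_continuous_map_preimage[OF continuous_chart, of W] assms dom_Int by simp
  then show ?thesis using openin_dom by (rule openin_trans_full)
qed

lemma open_chart_inv_preimage:
  assumes "openin (lg_topology G) W"
  shows "open {x \<in> snd \<kappa> ` fst \<kappa>. chart_inv \<kappa> x \<in> W}"
  using openin_continuous_map_preimage[OF continuous_chart_inv assms] by (simp add: openin_open_eq[OF open_range])

end

subsection \<open>Multiplication and inversion\<close>

text \<open>Three independent charts are allowed because conjugation by an element far from the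
  identity passes through charts around that element and around its inverse.\<close>

definition mult_chart_dom :: "('g, 'v) lie_group_data \<Rightarrow> ('g, 'v) chart \<Rightarrow> ('g, 'v) chart \<Rightarrow> ('g, 'v) chart \<Rightarrow> ('v \<times> 'v) set" where
  "mult_chart_dom G \<kappa> \<rho> \<tau> =
     {p \<in> (snd \<kappa> ` fst \<kappa>) \<times> (snd \<rho> ` fst \<rho>). chart_inv \<kappa> (fst p) \<otimes>\<^bsub>G\<^esub> chart_inv \<rho> (snd p) \<in> fst \<tau>}"

definition mult_chart :: "('g, 'v) lie_group_data \<Rightarrow> ('g, 'v) chart \<Rightarrow> ('g, 'v) chart \<Rightarrow> ('g, 'v) chart \<Rightarrow> 'v \<times> 'v \<Rightarrow> 'v" where
  "mult_chart G \<kappa> \<rho> \<tau> p = snd \<tau> (chart_inv \<kappa> (fst p) \<otimes>\<^bsub>G\<^esub> chart_inv \<rho> (snd p))"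

context
  fixes G :: "('g, 'v::euclidean_space) lie_group_data" and \<kappa> \<rho> \<tau> :: "('g, 'v) chart"
  assumes lie: "lie_group G" and \<kappa>: "\<kappa> \<in> lg_atlas G" and \<rho>: "\<rho> \<in> lg_atlas G" and \<tau>: "\<tau> \<in> lg_atlas G"
begin

interpretation K: lie_chart G \<kappa> by unfold_locales (rule lie \<kappa>)+
interpretation R: lie_chart G \<rho> by unfold_locales (rule lie \<rho>)+
interpretation T: lie_chart G \<tau> by unfold_locales (rule lie \<tau>)+

lemma open_mult_chart_dom: "open (mult_chart_dom G \<kappa> \<rho> \<tau>)"
proof -
  let ?S = "(snd \<kappa> ` fst \<kappa>) \<times> (snd \<rho> ` fst \<rho>)"
  have "continuous_map (top_of_set ?S) (top_of_set (snd \<kappa> ` fst \<kappa>)) fst"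
    "continuous_map (top_of_set ?S) (top_of_set (snd \<rho> ` fst \<rho>)) snd"
    by (auto simp: continuous_map_in_subtopology continuous_on_fst continuous_on_snd)
  from continuous_map_compose[OF this(1) K.continuous_chart_inv] continuous_map_compose[OF this(2) R.continuous_chart_inv]
  have "continuous_map (top_of_set ?S) (lg_topology G) (\<lambda>p. chart_inv \<kappa> (fst p) \<otimes>\<^bsub>G\<^esub> chart_inv \<rho> (snd p))"
    unfolding o_def by (rule lie_group_continuous_mult2[OF lie])
  from openin_continuous_map_preimage[OF this T.openin_dom]
  have "openin (top_of_set ?S) (mult_chart_dom G \<kappa> \<rho> \<tau>)" by (simp add: mult_chart_dom_def)
  then show ?thesis by (simp add: openin_open_eq[OF open_Times[OF K.open_range R.open_range]])
qed

lemma k_smooth_on_mult_chart: "k_smooth_on k (mult_chart_dom G \<kappa> \<rho> \<tau>) (mult_chart G \<kappa> \<rho> \<tau>)"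
proof -
  let ?pc = "prod_chart \<kappa> \<rho>" and ?f = "\<lambda>(g, h). g \<otimes>\<^bsub>G\<^esub> h"
  let ?D = "snd ?pc ` (fst ?pc \<inter> ?f -` fst \<tau>)"
  have pc: "?pc \<in> prod_atlas (lg_atlas G) (lg_atlas G)" using \<kappa> \<rho> unfolding prod_atlas_def by blast
  have "smooth_map (prod_topology (lg_topology G) (lg_topology G)) (prod_atlas (lg_atlas G) (lg_atlas G))
       (lg_topology G) (lg_atlas G) ?f"
    using lie by (simp add: lie_group_def)
  then have "smooth_on ?D (snd \<tau> \<circ> ?f \<circ> chart_inv ?pc)"
    using pc \<tau> by (rule smooth_map_in_charts)
  then have s: "k_smooth_on k ?D (snd \<tau> \<circ> ?f \<circ> chart_inv ?pc)" by (rule smooth_on_imp_k_smooth_on)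
  have inj: "inj_on (map_prod (snd \<kappa>) (snd \<rho>)) (fst \<kappa> \<times> fst \<rho>)"
    using K.inj_chart R.inj_chart by (rule map_prod_inj_on)
  have ci: "chart_inv ?pc (snd \<kappa> g, snd \<rho> h) = (g, h)" if "g \<in> fst \<kappa>" "h \<in> fst \<rho>" for g h
    using inv_into_f_f[OF inj, of "(g, h)"] that by (simp add: prod_chart_def)
  have D: "?D = mult_chart_dom G \<kappa> \<rho> \<tau>"
    by (force simp: mult_chart_dom_def prod_chart_def image_iff)
  show ?thesis
    using s unfolding D
  proof (rule k_smooth_on_cong[OF open_mult_chart_dom, rotated])
    fix p assume "p \<in> mult_chart_dom G \<kappa> \<rho> \<tau>"
    then obtain g h where "g \<in> fst \<kappa>" "h \<in> fst \<rho>" "p = (snd \<kappa> g, snd \<rho> h)"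
      by (auto simp: mult_chart_dom_def)
    then show "(snd \<tau> \<circ> ?f \<circ> chart_inv ?pc) p = mult_chart G \<kappa> \<rho> \<tau> p"
      by (simp add: ci mult_chart_def)
  qed
qed

end

context lie_chart
begin

interpretation group G using lie by (rule lie_group_group)

definition inv_chart_dom :: "'v set" where
  "inv_chart_dom = {x \<in> snd \<kappa> ` fst \<kappa>. inv\<^bsub>G\<^esub> (chart_inv \<kappa> x) \<in> fst \<kappa>}"

lemma open_inv_chart_dom: "open inv_chart_dom"
proof -
  have "continuous_map (lg_topology G) (lg_topology G) (\<lambda>g. inv\<^bsub>G\<^esub> g)"
    using lie by (simp add: lie_group_def smooth_map_def)
  from openin_continuous_map_preimage[OF continuous_map_compose[OF continuous_chart_inv this] openin_dom]
  show ?thesis by (simp add: openin_open_eq[OF open_range] inv_chart_dom_def)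
qed

lemma k_smooth_on_inv_chart: "k_smooth_on k inv_chart_dom (\<lambda>x. snd \<kappa> (inv\<^bsub>G\<^esub> (chart_inv \<kappa> x)))"
proof -
  have "snd \<kappa> ` (fst \<kappa> \<inter> m_inv G -` fst \<kappa>) = inv_chart_dom"
    by (force simp: inv_chart_dom_def)
  moreover have "smooth_map (lg_topology G) (lg_atlas G) (lg_topology G) (lg_atlas G) (m_inv G)"
    using lie by (simp add: lie_group_def)
  then have "smooth_on (snd \<kappa> ` (fst \<kappa> \<inter> m_inv G -` fst \<kappa>)) (snd \<kappa> \<circ> m_inv G \<circ> chart_inv \<kappa>)"
    using atlas atlas by (rule smooth_map_in_charts)
  ultimately show ?thesis by (simp add: smooth_on_def o_def)
qed

definition conj_chart :: "'v \<times> 'v \<Rightarrow> 'v" where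
  "conj_chart p = snd \<kappa> (inv\<^bsub>G\<^esub> chart_inv \<kappa> (fst p) \<otimes>\<^bsub>G\<^esub> chart_inv \<kappa> (snd p) \<otimes>\<^bsub>G\<^esub> chart_inv \<kappa> (fst p))"

text \<open>Conjugation is composed as x\<inverse> (y x), that is, one inversion and two
  multiplications. The open set collects the pairs for which every intermediate value lies in the
  chart.\<close>

lemma conj_chart_smooth:
  assumes "\<one>\<^bsub>G\<^esub> \<in> fst \<kappa>"
  obtains S where "open S" "(snd \<kappa> \<one>\<^bsub>G\<^esub>, snd \<kappa> \<one>\<^bsub>G\<^esub>) \<in> S" "\<And>k. k_smooth_on k S conj_chart"
proof -
  let ?i = "\<lambda>x. snd \<kappa> (inv\<^bsub>G\<^esub> (chart_inv \<kappa> x))"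
  let ?m = "mult_chart G \<kappa> \<kappa> \<kappa>" and ?M = "mult_chart_dom G \<kappa> \<kappa> \<kappa>"
  let ?sw = "\<lambda>p :: 'v \<times> 'v. (snd p, fst p)"
  define D where "D = fst -` inv_chart_dom \<inter> ?sw -` ?M"
  define F where "F p = (?i (fst p), ?m (?sw p))" for p
  have sw: "bounded_linear ?sw" by (intro bounded_linear_Pair bounded_linear_snd bounded_linear_fst)
  have oM: "open ?M" by (rule open_mult_chart_dom[OF lie atlas atlas atlas])
  have sM: "k_smooth_on k ?M ?m" for k by (rule k_smooth_on_mult_chart[OF lie atlas atlas atlas])
  have oD: "open D"
    unfolding D_def using oM open_inv_chart_dom
    by (intro open_Int open_vimage linear_continuous_on[OF sw]) (auto intro!: continuous_intros)
  have F: "k_smooth_on k D F" for k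
    unfolding F_def
  proof (rule k_smooth_on_Pair[OF oD])
    show "k_smooth_on k D (\<lambda>p. ?i (fst p))"
      using oD open_inv_chart_dom k_smooth_on_inv_chart k_smooth_on_bounded_linear_id[OF bounded_linear_fst]
      by (intro k_smooth_on_compose[where f = ?i and g = fst and T = inv_chart_dom]) (auto simp: D_def)
    show "k_smooth_on k D (\<lambda>p. ?m (?sw p))"
      using oD oM sM k_smooth_on_bounded_linear_id[OF sw]
      by (intro k_smooth_on_compose[where f = ?m and g = ?sw and T = ?M]) (auto simp: D_def)
  qed
  have oS: "open (D \<inter> F -` ?M)"
    using F[of 0] oD oM by (auto intro: continuous_open_preimage)
  show ?thesis
  proof (rule that[OF oS])
    show "(snd \<kappa> \<one>\<^bsub>G\<^esub>, snd \<kappa> \<one>\<^bsub>G\<^esub>) \<in> D \<inter> F -` ?M"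
      using assms by (simp add: D_def F_def inv_chart_dom_def mult_chart_dom_def mult_chart_def)
    show "k_smooth_on k (D \<inter> F -` ?M) conj_chart" for k
    proof (rule k_smooth_on_cong[OF oS])
      show "k_smooth_on k (D \<inter> F -` ?M) (\<lambda>p. ?m (F p))"
        using oS oM sM k_smooth_on_subset[OF F] by (intro k_smooth_on_compose[where f = ?m and g = F and T = ?M]) auto
      show "?m (F p) = conj_chart p" if "p \<in> D \<inter> F -` ?M" for p
      proof -
        obtain x y where p: "p = (x, y)" by (cases p)
        have xy: "x \<in> snd \<kappa> ` fst \<kappa>" "y \<in> snd \<kappa> ` fst \<kappa>" "inv\<^bsub>G\<^esub> chart_inv \<kappa> x \<in> fst \<kappa>"
          "chart_inv \<kappa> y \<otimes>\<^bsub>G\<^esub> chart_inv \<kappa> x \<in> fst \<kappa>"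
          using that by (auto simp: p D_def inv_chart_dom_def mult_chart_dom_def)
        then show ?thesis
          using dom_carrier[OF chart_inv_mem[OF xy(1)]] dom_carrier[OF chart_inv_mem[OF xy(2)]]
          by (simp add: F_def p mult_chart_def conj_chart_def m_assoc)
      qed
    qed
  qed
qed

end

subsection \<open>The adjoint representation\<close>

locale lie_chart_one = lie_chart G \<kappa>
  for G :: "('g, 'v::euclidean_space) lie_group_data" and \<kappa> :: "('g, 'v) chart" +
  assumes one_dom: "\<one>\<^bsub>G\<^esub> \<in> fst \<kappa>"
begin

interpretation group G using lie by (rule lie_group_group)

abbreviation e where "e \<equiv> snd \<kappa> \<one>\<^bsub>G\<^esub>"

lemma e_range: "e \<in> snd \<kappa> ` fst \<kappa>" and chart_inv_e [simp]: "chart_inv \<kappa> e = \<one>\<^bsub>G\<^esub>"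
  using one_dom by auto

text \<open>\<open>Ad\<close> is defined by \<open>frechet_derivative\<close>, so differentiability
  has to be proved for every \<open>g\<close>, including those outside \<kappa>. The map is factored
  as h \<mapsto> h g, read in a chart \<rho> around \<open>g\<close>, followed by left translation
  by the inverse of \<open>g\<close>, read through a chart \<tau> around that inverse and back into
  \<kappa>.\<close>

lemma Ad_has_derivative:
  assumes g: "g \<in> carrier G"
  shows "((\<lambda>x. snd \<kappa> (inv\<^bsub>G\<^esub> g \<otimes>\<^bsub>G\<^esub> chart_inv \<kappa> x \<otimes>\<^bsub>G\<^esub> g)) has_derivative Ad G \<kappa> g) (at e)"
proof -
  obtain \<rho> where \<rho>: "\<rho> \<in> lg_atlas G" "g \<in> fst \<rho>" using lie_group_chart_ex[OF lie g] .
  obtain \<tau> where \<tau>: "\<tau> \<in> lg_atlas G" "inv\<^bsub>G\<^esub> g \<in> fst \<tau>" using lie_group_chart_ex[OF lie inv_closed[OF g]] .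
  interpret R: lie_chart G \<rho> by unfold_locales (rule lie \<rho>)+
  interpret T: lie_chart G \<tau> by unfold_locales (rule lie \<tau>)+
  define x1 where "x1 = snd \<rho> g"
  define x2 where "x2 = snd \<tau> (inv\<^bsub>G\<^esub> g)"
  let ?M1 = "mult_chart G \<kappa> \<rho> \<rho>" and ?D1 = "mult_chart_dom G \<kappa> \<rho> \<rho>"
  let ?M2 = "mult_chart G \<tau> \<rho> \<kappa>" and ?D2 = "mult_chart_dom G \<tau> \<rho> \<kappa>"
  have D1: "(e, x1) \<in> ?D1" using one_dom \<rho> g by (simp add: x1_def mult_chart_dom_def)
  have D2: "(x2, x1) \<in> ?D2" using one_dom \<rho> \<tau> g by (simp add: x1_def x2_def mult_chart_dom_def)
  have "?M1 differentiable at (e, x1)"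
    using k_smooth_on_mult_chart[OF lie atlas \<rho>(1) \<rho>(1), of "Suc 0"] D1 by simp
  moreover have "(\<lambda>x. (x, x1)) differentiable at e" by (intro differentiable_Pair) auto
  ultimately have 1: "(\<lambda>x. ?M1 (x, x1)) differentiable at e"
    using differentiable_chain_at[of "\<lambda>x. (x, x1)" e ?M1] by (simp add: o_def)
  have M1e: "?M1 (e, x1) = x1" using \<rho> g by (simp add: mult_chart_def x1_def)
  have "?M2 differentiable at (x2, x1)"
    using k_smooth_on_mult_chart[OF lie \<tau>(1) \<rho>(1) atlas, of "Suc 0"] D2 by simp
  moreover have "(\<lambda>x. (x2, x)) differentiable at x1" by (intro differentiable_Pair) auto
  ultimately have "(\<lambda>x. ?M2 (x2, x)) differentiable at (?M1 (e, x1))"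
    using differentiable_chain_at[of "\<lambda>x. (x2, x)" x1 ?M2] M1e by (simp add: o_def)
  from differentiable_chain_at[OF 1 this]
  have d: "(\<lambda>x. ?M2 (x2, ?M1 (x, x1))) differentiable at e" by (simp add: o_def)
  let ?N = "(\<lambda>x. (x, x1)) -` ?D1"
  have "open ?N"
    using open_mult_chart_dom[OF lie atlas \<rho>(1) \<rho>(1)] by (intro open_vimage) (auto intro!: continuous_intros)
  moreover have "e \<in> ?N" using D1 by simp
  moreover have "?M2 (x2, ?M1 (x, x1)) = snd \<kappa> (inv\<^bsub>G\<^esub> g \<otimes>\<^bsub>G\<^esub> chart_inv \<kappa> x \<otimes>\<^bsub>G\<^esub> g)" if "x \<in> ?N" for x
    using that \<rho> \<tau> g dom_carrier[OF chart_inv_mem]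
    by (auto simp: mult_chart_def mult_chart_dom_def x1_def x2_def m_assoc)
  ultimately have "(\<lambda>x. snd \<kappa> (inv\<^bsub>G\<^esub> g \<otimes>\<^bsub>G\<^esub> chart_inv \<kappa> x \<otimes>\<^bsub>G\<^esub> g)) differentiable at e"
    using d unfolding differentiable_def by (blast intro: has_derivative_transform_within_open)
  then show ?thesis by (simp add: Ad_def frechet_derivative_works o_def)
qed

lemma bounded_linear_Ad: "g \<in> carrier G \<Longrightarrow> bounded_linear (Ad G \<kappa> g)"
  using Ad_has_derivative by (rule has_derivative_bounded_linear)

lemma open_conj_dom:
  assumes "g \<in> carrier G"
  shows "open {x \<in> snd \<kappa> ` fst \<kappa>. inv\<^bsub>G\<^esub> g \<otimes>\<^bsub>G\<^esub> chart_inv \<kappa> x \<otimes>\<^bsub>G\<^esub> g \<in> fst \<kappa>}"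
proof -
  have "openin (lg_topology G) {h \<in> carrier G. inv\<^bsub>G\<^esub> g \<otimes>\<^bsub>G\<^esub> h \<otimes>\<^bsub>G\<^esub> g \<in> fst \<kappa>}"
    using openin_continuous_map_preimage[OF lie_group_continuous_conj[OF lie inv_closed[OF assms] assms] openin_dom]
    by (simp add: lie_group_topspace[OF lie])
  from open_chart_inv_preimage[OF this]
  show ?thesis by (rule back_subst[where P = "open"]) (use dom_carrier chart_inv_mem in blast)
qed

lemma Ad_one: "Ad G \<kappa> \<one>\<^bsub>G\<^esub> = id"
proof -
  have "((\<lambda>x. snd \<kappa> (inv\<^bsub>G\<^esub> \<one>\<^bsub>G\<^esub> \<otimes>\<^bsub>G\<^esub> chart_inv \<kappa> x \<otimes>\<^bsub>G\<^esub> \<one>\<^bsub>G\<^esub>)) has_derivative id) (at e)"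
    by (rule has_derivative_transform_within_open[OF has_derivative_id[unfolded id_def[symmetric]] open_range e_range])
      (simp add: dom_carrier chart_inv_mem chart_of_inv)
  with Ad_has_derivative[OF one_closed] show ?thesis by (rule has_derivative_unique)
qed

text \<open>The order is reversed because conjugation with the inverse on the left satisfies (g
  h)\<inverse> x (g h) = h\<inverse> (g\<inverse> x g) h; the rest is the chain rule at the fixed
  point \<open>e\<close>.\<close>

lemma Ad_mult:
  assumes g: "g \<in> carrier G" and h: "h \<in> carrier G"
  shows "Ad G \<kappa> (g \<otimes>\<^bsub>G\<^esub> h) = Ad G \<kappa> h \<circ> Ad G \<kappa> g"
proof -
  let ?c = "\<lambda>g x. snd \<kappa> (inv\<^bsub>G\<^esub> g \<otimes>\<^bsub>G\<^esub> chart_inv \<kappa> x \<otimes>\<^bsub>G\<^esub> g)"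
  have "?c g e = e" using g by simp
  then have "(?c h has_derivative Ad G \<kappa> h) (at (?c g e))" using Ad_has_derivative[OF h] by simp
  with Ad_has_derivative[OF g] have "(?c h \<circ> ?c g has_derivative Ad G \<kappa> h \<circ> Ad G \<kappa> g) (at e)"
    by (rule diff_chain_at)
  then have "(?c (g \<otimes>\<^bsub>G\<^esub> h) has_derivative Ad G \<kappa> h \<circ> Ad G \<kappa> g) (at e)"
  proof (rule has_derivative_transform_within_open[OF _ open_conj_dom[OF g]])
    fix x assume x: "x \<in> {x \<in> snd \<kappa> ` fst \<kappa>. inv\<^bsub>G\<^esub> g \<otimes>\<^bsub>G\<^esub> chart_inv \<kappa> x \<otimes>\<^bsub>G\<^esub> g \<in> fst \<kappa>}"
    then have "chart_inv \<kappa> x \<in> carrier G" using dom_carrier chart_inv_mem by blast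
    with x g h show "(?c h \<circ> ?c g) x = ?c (g \<otimes>\<^bsub>G\<^esub> h) x"
      by (simp add: inv_mult_group m_assoc)
  qed (use e_range one_dom g in simp)
  with Ad_has_derivative[OF m_closed[OF g h]] show ?thesis by (rule has_derivative_unique)
qed

subsection \<open>One-parameter subgroups\<close>

abbreviation m where "m \<equiv> mult_chart G \<kappa> \<kappa> \<kappa>"
abbreviation m_dom where "m_dom \<equiv> mult_chart_dom G \<kappa> \<kappa> \<kappa>"
abbreviation m' where "m' p \<equiv> frechet_derivative m (at p)"

text \<open>The right invariant vector field generated by \<xi>, read in the chart: right
  translation by the point y is differentiated at the identity in direction \<xi>.\<close>

definition right_inv_field :: "'v \<Rightarrow> 'v \<Rightarrow> 'v" where
  "right_inv_field \<xi> y = m' (e, y) (\<xi>, 0)"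

lemma open_m_dom: "open m_dom" and k_smooth_on_m: "k_smooth_on k m_dom m"
  using open_mult_chart_dom k_smooth_on_mult_chart lie atlas by blast+

lemma m_has_derivative: "p \<in> m_dom \<Longrightarrow> (m has_derivative m' p) (at p)"
  using k_smooth_on_differentiable[OF k_smooth_on_m] .

lemma e_m_dom: "x \<in> snd \<kappa> ` fst \<kappa> \<Longrightarrow> (e, x) \<in> m_dom"
  and m_e: "x \<in> snd \<kappa> ` fst \<kappa> \<Longrightarrow> m (e, x) = x"
  and m_e': "x \<in> snd \<kappa> ` fst \<kappa> \<Longrightarrow> m (x, e) = x"
  using one_dom by (auto simp: mult_chart_dom_def mult_chart_def dom_carrier)

lemma m_chart: "g \<in> fst \<kappa> \<Longrightarrow> h \<in> fst \<kappa> \<Longrightarrow> m (snd \<kappa> g, snd \<kappa> h) = snd \<kappa> (g \<otimes>\<^bsub>G\<^esub> h)"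
  by (simp add: mult_chart_def)

lemma m'_left: "(x, z) \<in> m_dom \<Longrightarrow> ((\<lambda>x. m (x, z)) has_derivative (\<lambda>\<xi>. m' (x, z) (\<xi>, 0))) (at x)"
  by (rule has_derivative_compose[where f = "\<lambda>x. (x, z)"]) (auto intro!: derivative_eq_intros m_has_derivative)

lemma right_inv_field_e: "right_inv_field \<xi> e = \<xi>"
proof -
  have "((\<lambda>x. m (x, e)) has_derivative (\<lambda>\<xi>. \<xi>)) (at e)"
    by (rule has_derivative_transform_within_open[OF has_derivative_ident open_range e_range]) (simp add: m_e')
  then have "(\<lambda>\<xi>. m' (e, e) (\<xi>, 0)) = (\<lambda>\<xi>. \<xi>)"
    using m'_left[OF e_m_dom[OF e_range]] has_derivative_unique by blast
  then show ?thesis by (metis right_inv_field_def)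
qed

text \<open>Differentiate \<open>(\<sigma> x) z = \<sigma> (x z)\<close> in \<open>\<sigma>\<close> at the identity.\<close>

lemma right_inv_field_m:
  assumes xz: "(x, z) \<in> m_dom"
  shows "m' (x, z) (right_inv_field \<xi> x, 0) = right_inv_field \<xi> (m (x, z))"
proof -
  have x: "x \<in> snd \<kappa> ` fst \<kappa>" and z: "z \<in> snd \<kappa> ` fst \<kappa>"
    and p: "chart_inv \<kappa> x \<otimes>\<^bsub>G\<^esub> chart_inv \<kappa> z \<in> fst \<kappa>"
    using xz by (auto simp: mult_chart_dom_def)
  have y: "m (x, z) \<in> snd \<kappa> ` fst \<kappa>" using p by (auto simp: mult_chart_def)
  let ?N = "(\<lambda>\<sigma>. (\<sigma>, x)) -` m_dom"
  have "open ?N" using open_m_dom by (intro open_vimage) (auto intro!: continuous_intros)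
  have "((\<lambda>\<sigma>. m (\<sigma>, z)) has_derivative (\<lambda>\<xi>. m' (x, z) (\<xi>, 0))) (at (m (e, x)))"
    using m'_left[OF xz] by (simp add: m_e[OF x])
  from has_derivative_compose[OF m'_left[OF e_m_dom[OF x]] this]
  have "((\<lambda>\<sigma>. m (m (\<sigma>, x), z)) has_derivative (\<lambda>\<xi>. m' (x, z) (m' (e, x) (\<xi>, 0), 0))) (at e)" .
  then have "((\<lambda>\<sigma>. m (\<sigma>, m (x, z))) has_derivative (\<lambda>\<xi>. m' (x, z) (m' (e, x) (\<xi>, 0), 0))) (at e)"
  proof (rule has_derivative_transform_within_open[OF _ \<open>open ?N\<close>])
    fix \<sigma> assume "\<sigma> \<in> ?N"
    then show "m (m (\<sigma>, x), z) = m (\<sigma>, m (x, z))"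
      using x z p dom_carrier[OF chart_inv_mem]
      by (auto simp: mult_chart_dom_def mult_chart_def m_assoc)
  qed (use e_m_dom[OF x] in simp)
  with m'_left[OF e_m_dom[OF y]]
  have "(\<lambda>\<xi>. m' (e, m (x, z)) (\<xi>, 0)) = (\<lambda>\<xi>. m' (x, z) (m' (e, x) (\<xi>, 0), 0))"
    by (rule has_derivative_unique)
  then show ?thesis unfolding right_inv_field_def by metis
qed

text \<open>The field is a directional derivative of the smooth map \<open>m\<close>, hence of class
  C^1 in the pair of arguments; its Lipschitz bound is restricted to the slice whose first
  coordinate is \<open>e\<close>.\<close>

lemma right_inv_field_lipschitz:
  obtains \<rho> L where "\<rho> > 0" "L \<ge> 0" "cball e \<rho> \<subseteq> snd \<kappa> ` fst \<kappa>"
    "\<And>y z. y \<in> cball e \<rho> \<Longrightarrow> z \<in> cball e \<rho> \<Longrightarrow>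
      norm (right_inv_field \<xi> y - right_inv_field \<xi> z) \<le> L * norm (y - z)"
proof -
  have "k_smooth_on (Suc 0) m_dom (\<lambda>p. m' p (\<xi>, 0))"
    using k_smooth_on_m[of "Suc (Suc 0)"] unfolding k_smooth_on.simps(2)[of "Suc 0"] by blast
  from k_smooth_on_locally_lipschitz[OF open_m_dom this e_m_dom[OF e_range]]
  obtain \<rho> L where *: "\<rho> > 0" "L \<ge> 0" "cball (e, e) \<rho> \<subseteq> m_dom"
    "\<And>p q. p \<in> cball (e, e) \<rho> \<Longrightarrow> q \<in> cball (e, e) \<rho> \<Longrightarrow>
        norm (m' p (\<xi>, 0) - m' q (\<xi>, 0)) \<le> L * norm (p - q)" by metis
  have pr: "(e, y) \<in> cball (e, e) \<rho>" if "y \<in> cball e \<rho>" for y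
    using that by (simp add: dist_Pair_Pair)
  show ?thesis
  proof (rule that[OF *(1,2)])
    show "cball e \<rho> \<subseteq> snd \<kappa> ` fst \<kappa>"
      using pr *(3) by (fastforce simp: mult_chart_dom_def)
    show "norm (right_inv_field \<xi> y - right_inv_field \<xi> z) \<le> L * norm (y - z)"
      if "y \<in> cball e \<rho>" "z \<in> cball e \<rho>" for y z
      using *(4)[OF pr[OF that(1)] pr[OF that(2)]] by (simp add: right_inv_field_def norm_Pair)
  qed
qed

end

text \<open>Every time becomes small after division by some n, and \<gamma>(t/n) to the power n does
  not depend on n. Additivity is then checked with a single n that serves s, t and s + t.\<close>

lemma (in group) extend_local_one_parameter_subgroup:
  fixes \<gamma> :: "real \<Rightarrow> 'a"
  assumes r: "r > 0" and cl: "\<And>t. \<bar>t\<bar> < r \<Longrightarrow> \<gamma> t \<in> carrier G"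
    and add: "\<And>s t. \<bar>s\<bar> < r \<Longrightarrow> \<bar>t\<bar> < r \<Longrightarrow> \<bar>s + t\<bar> < r \<Longrightarrow> \<gamma> (s + t) = \<gamma> s \<otimes> \<gamma> t"
  obtains c where "\<And>t. c t \<in> carrier G" "\<And>s t. c (s + t) = c s \<otimes> c t"
    "\<And>t. \<bar>t\<bar> < r \<Longrightarrow> c t = \<gamma> t"
proof -
  have \<gamma>0: "\<gamma> 0 = \<one>" using add[of 0 0] cl[of 0] r by (simp add: r_cancel_one')
  have pow: "\<gamma> (real k * s) = \<gamma> s [^] k" if "\<bar>real k * s\<bar> < r" for k s
    using that
  proof (induction k)
    case 0
    then show ?case by (simp add: \<gamma>0)
  next
    case (Suc k)
    have le: "\<bar>real k * s\<bar> \<le> \<bar>real (Suc k) * s\<bar>" "\<bar>s\<bar> \<le> \<bar>real (Suc k) * s\<bar>"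
      by (simp_all add: abs_mult mult_right_mono mult_le_cancel_right1)
    with Suc.prems have "\<bar>real k * s\<bar> < r" "\<bar>s\<bar> < r" by linarith+
    moreover have "real k * s + s = real (Suc k) * s" by (simp add: algebra_simps)
    ultimately show ?case using add[of "real k * s" s] Suc by simp
  qed
  define c where "c t = (let n = SOME n. 0 < n \<and> \<bar>t / real n\<bar> < r in \<gamma> (t / real n) [^] n)" for t
  have ex: "\<exists>n>0. \<bar>s / real n\<bar> < r \<and> \<bar>t / real n\<bar> < r \<and> \<bar>(s + t) / real n\<bar> < r" for s t
  proof -
    obtain n where "(\<bar>s\<bar> + \<bar>t\<bar>) / r < real n" using reals_Archimedean2 by blast
    moreover then have "real n > 0" using r by (meson abs_ge_zero add_nonneg_nonneg divide_nonneg_pos le_less_trans)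
    ultimately have "n > 0" "(\<bar>s\<bar> + \<bar>t\<bar>) / real n < r" using r by (auto simp: field_simps)
    moreover have "\<bar>s\<bar> / real n \<le> (\<bar>s\<bar> + \<bar>t\<bar>) / real n" "\<bar>t\<bar> / real n \<le> (\<bar>s\<bar> + \<bar>t\<bar>) / real n"
      "\<bar>s + t\<bar> / real n \<le> (\<bar>s\<bar> + \<bar>t\<bar>) / real n"
      by (intro divide_right_mono; simp)+
    ultimately show ?thesis by (intro exI[of _ n]) (auto simp: abs_divide)
  qed
  have eq: "\<gamma> (t / real n) [^] n = \<gamma> (t / real k) [^] k"
    if "n > 0" "k > 0" "\<bar>t / real n\<bar> < r" "\<bar>t / real k\<bar> < r" for n k t
  proof -
    \<comment> \<open>Independence of the divisor: the expressions for n and k both equal the one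
      for the common refinement n k.\<close>
    have sub: "\<gamma> (t / real n) [^] n = \<gamma> (t / real (n * k)) [^] (k * n)"
      if "n > 0" "k > 0" "\<bar>t / real n\<bar> < r" for n k
    proof -
      have e: "real k * (t / real (n * k)) = t / real n" using that by simp
      have "\<bar>t / real (n * k)\<bar> \<le> \<bar>t / real n\<bar>"
        using that by (simp add: abs_divide frac_le mult_le_cancel_left1)
      then have "\<gamma> (t / real (n * k)) \<in> carrier G" using that by (intro cl) linarith
      then show ?thesis using pow[of k "t / real (n * k)"] that unfolding e by (simp add: nat_pow_pow)
    qed
    show ?thesis using sub[OF that(1,2,3)] sub[OF that(2,1,4)] by (simp add: mult.commute)
  qed
  have c: "c t = \<gamma> (t / real n) [^] n" if "n > 0" "\<bar>t / real n\<bar> < r" for t n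
  proof -
    have "0 < (SOME n. 0 < n \<and> \<bar>t / real n\<bar> < r) \<and> \<bar>t / real (SOME n. 0 < n \<and> \<bar>t / real n\<bar> < r)\<bar> < r"
      by (rule someI[of "\<lambda>n. 0 < n \<and> \<bar>t / real n\<bar> < r"]) (use that in simp)
    then show ?thesis unfolding c_def Let_def using that by (intro eq) auto
  qed
  show ?thesis
  proof (rule that[of c])
    show "c t \<in> carrier G" for t
    proof -
      obtain n where n: "n > 0" "\<bar>t / real n\<bar> < r" using ex[of t t] by blast
      show ?thesis unfolding c[OF n] using cl[OF n(2)] by simp
    qed
    show "c (s + t) = c s \<otimes> c t" for s t
    proof -
      obtain n where n: "n > 0" "\<bar>s / real n\<bar> < r" "\<bar>t / real n\<bar> < r" "\<bar>(s + t) / real n\<bar> < r"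
        using ex[of s t] by blast
      then have a: "\<gamma> ((s + t) / real n) = \<gamma> (s / real n) \<otimes> \<gamma> (t / real n)"
        using add[of "s / real n" "t / real n"] by (simp add: add_divide_distrib)
      \<comment> \<open>Addition of reals commutes, so the two group elements commute and the power
        of their product splits.\<close>
      moreover have "\<gamma> ((s + t) / real n) = \<gamma> (t / real n) \<otimes> \<gamma> (s / real n)"
        using n add[of "t / real n" "s / real n"] by (simp add: add_divide_distrib add.commute)
      ultimately show ?thesis
        using cl n unfolding c[OF n(1,2)] c[OF n(1,3)] c[OF n(1,4)] a by (intro pow_mult_distrib) auto
    qed
    show "c t = \<gamma> t" if "\<bar>t\<bar> < r" for t
      using c[of 1 t] that cl by simp
  qed
qed

context lie_chart_one
begin

interpretation group G using lie by (rule lie_group_group)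

lemma
  assumes "continuous_map euclidean (lg_topology G) c"
    and add: "\<And>s t :: real. c (s + t) = c s \<otimes>\<^bsub>G\<^esub> c t"
  shows one_parameter_carrier: "c t \<in> carrier G"
    and one_parameter_zero: "c 0 = \<one>\<^bsub>G\<^esub>"
    and one_parameter_minus: "c (- t) = inv\<^bsub>G\<^esub> c t"
proof -
  show cl: "c t \<in> carrier G" for t
    using continuous_map_funspace[OF assms(1)] by (auto simp: lie_group_topspace[OF lie])
  show 0: "c 0 = \<one>\<^bsub>G\<^esub>" using add[of 0 0] cl[of 0] by (simp add: r_cancel_one')
  have "c (- t) \<otimes>\<^bsub>G\<^esub> c t = \<one>\<^bsub>G\<^esub>" using add[of "- t" t] 0 by simp
  then show "c (- t) = inv\<^bsub>G\<^esub> c t" using cl by (simp add: inv_equality)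
qed

lemma open_one_parameter_preimage:
  assumes "continuous_map euclidean (lg_topology G) c"
  shows "open {t. c t \<in> fst \<kappa>}"
  using openin_continuous_map_preimage[OF assms openin_dom] by simp

text \<open>Near s = 0 the curve satisfies c(s + t) = c(s) c(t), and the derivative of the
  right-hand side in s involves only the given velocity \<xi> at time 0.\<close>

lemma one_parameter_ode:
  assumes c: "one_parameter_subgroup G \<kappa> \<xi> c" and t: "c t \<in> fst \<kappa>"
  shows "((\<lambda>t. snd \<kappa> (c t)) has_vector_derivative right_inv_field \<xi> (snd \<kappa> (c t))) (at t)"
proof -
  have cont: "continuous_map euclidean (lg_topology G) c" and add: "\<And>s t. c (s + t) = c s \<otimes>\<^bsub>G\<^esub> c t"
    and d: "((\<lambda>t. snd \<kappa> (c t)) has_derivative (\<lambda>s. s *\<^sub>R \<xi>)) (at 0)"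
    using c by (auto simp: one_parameter_subgroup_def has_vector_derivative_def)
  note c0 = one_parameter_zero[OF cont add]
  let ?x = "snd \<kappa> (c t)"
  have x: "?x \<in> snd \<kappa> ` fst \<kappa>" using t by simp
  have "((\<lambda>\<sigma>. m (\<sigma>, ?x)) has_derivative (\<lambda>\<xi>. m' (e, ?x) (\<xi>, 0))) (at (snd \<kappa> (c 0)))"
    using m'_left[OF e_m_dom[OF x]] by (simp add: c0)
  from has_derivative_compose[OF d this]
  have "((\<lambda>s. m (snd \<kappa> (c s), ?x)) has_derivative (\<lambda>s. m' (e, ?x) (s *\<^sub>R \<xi>, 0))) (at 0)" .
  then have "((\<lambda>s. snd \<kappa> (c (s + t))) has_derivative (\<lambda>s. m' (e, ?x) (s *\<^sub>R \<xi>, 0))) (at 0)"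
    by (rule has_derivative_transform_within_open[OF _ open_one_parameter_preimage[OF cont]])
      (use one_dom t in \<open>simp_all add: c0 m_chart add\<close>)
  moreover have "bounded_linear (m' (e, ?x))"
    using m_has_derivative[OF e_m_dom[OF x]] by (rule has_derivative_bounded_linear)
  then have "m' (e, ?x) (s *\<^sub>R \<xi>, 0) = s *\<^sub>R right_inv_field \<xi> ?x" for s
    unfolding right_inv_field_def using linear_simps(5)[of "m' (e, ?x)" s "(\<xi>, 0)"] by simp
  ultimately have "((\<lambda>s. snd \<kappa> (c (s + t))) has_vector_derivative right_inv_field \<xi> ?x) (at 0)"
    by (simp add: has_vector_derivative_def)
  moreover have "((\<lambda>s. s - t) has_vector_derivative 1) (at t)"
    by (auto intro!: derivative_eq_intros)
  ultimately show ?thesis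
    using vector_diff_chain_at[of "\<lambda>s. s - t" 1 t "\<lambda>s. snd \<kappa> (c (s + t))"] by (simp add: o_def)
qed

text \<open>The Lipschitz bound holds in a ball around \<open>e\<close>, and continuity keeps both
  curves there for a short time, so the differential equation forces agreement near 0. Any t is n
  times a small time, and both curves turn this multiple into an n-th power.\<close>

lemma one_parameter_unique:
  assumes c: "one_parameter_subgroup G \<kappa> \<xi> c" and d: "one_parameter_subgroup G \<kappa> \<xi> d"
  shows "c = d"
proof
  fix t
  obtain \<rho> L where \<rho>: "\<rho> > 0" "L \<ge> 0" "cball e \<rho> \<subseteq> snd \<kappa> ` fst \<kappa>"
    "\<And>y z. y \<in> cball e \<rho> \<Longrightarrow> z \<in> cball e \<rho> \<Longrightarrow>
      norm (right_inv_field \<xi> y - right_inv_field \<xi> z) \<le> L * norm (y - z)"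
    using right_inv_field_lipschitz[of \<xi>] by blast
  have near: "\<exists>r>0. \<forall>t. \<bar>t\<bar> < r \<longrightarrow> c t \<in> fst \<kappa> \<and> snd \<kappa> (c t) \<in> cball e \<rho>"
    if "one_parameter_subgroup G \<kappa> \<xi> c" for c
  proof -
    have cont: "continuous_map euclidean (lg_topology G) c" and add: "\<And>s t. c (s + t) = c s \<otimes>\<^bsub>G\<^esub> c t"
      using that by (auto simp: one_parameter_subgroup_def)
    have "open {t. c t \<in> {g \<in> fst \<kappa>. snd \<kappa> g \<in> ball e \<rho>}}"
      using openin_continuous_map_preimage[OF cont openin_chart_preimage[OF open_ball]] by simp
    moreover have "0 \<in> {t. c t \<in> {g \<in> fst \<kappa>. snd \<kappa> g \<in> ball e \<rho>}}"
      using one_dom \<rho>(1) by (simp add: one_parameter_zero[OF cont add])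
    ultimately obtain r where "r > 0" "ball 0 r \<subseteq> {t. c t \<in> {g \<in> fst \<kappa>. snd \<kappa> g \<in> ball e \<rho>}}"
      by (meson openE)
    then show ?thesis by (intro exI[of _ r]) (auto simp: subset_iff dist_real_def less_imp_le)
  qed
  obtain r1 where r1: "r1 > 0" "\<And>t. \<bar>t\<bar> < r1 \<Longrightarrow> c t \<in> fst \<kappa> \<and> snd \<kappa> (c t) \<in> cball e \<rho>"
    using near[OF c] by blast
  obtain r2 where r2: "r2 > 0" "\<And>t. \<bar>t\<bar> < r2 \<Longrightarrow> d t \<in> fst \<kappa> \<and> snd \<kappa> (d t) \<in> cball e \<rho>"
    using near[OF d] by blast
  define r where "r = min r1 r2"
  have cont: "continuous_map euclidean (lg_topology G) c" "continuous_map euclidean (lg_topology G) d"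
    and add: "\<And>s t. c (s + t) = c s \<otimes>\<^bsub>G\<^esub> c t" "\<And>s t. d (s + t) = d s \<otimes>\<^bsub>G\<^esub> d t"
    using c d by (auto simp: one_parameter_subgroup_def)
  note zero = one_parameter_zero[OF cont(1) add(1)] one_parameter_zero[OF cont(2) add(2)]
  have local: "c s = d s" if "\<bar>s\<bar> < r" for s
  proof -
    have "snd \<kappa> (c s) = snd \<kappa> (d s)"
      by (rule ode_unique[where r = r and V = "right_inv_field \<xi>" and S = "cball e \<rho>" and L = L])
        (use r1 r2 \<rho>(4) that one_parameter_ode[OF c] one_parameter_ode[OF d] in \<open>auto simp: zero r_def\<close>)
    then show ?thesis using inj_onD[OF inj_chart] r1(2)[of s] r2(2)[of s] that by (simp add: r_def)
  qed
  obtain n where n: "\<bar>t\<bar> / r < real n" using reals_Archimedean2 by blast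
  have "r > 0" using r1 r2 by (simp add: r_def)
  with n have npos: "n > 0" by (metis abs_ge_zero divide_nonneg_pos gr0I of_nat_0 not_less)
  with n \<open>r > 0\<close> have small: "\<bar>t / real n\<bar> < r" by (simp add: field_simps abs_divide)
  have "c (real k * s) = c s [^]\<^bsub>G\<^esub> k \<and> d (real k * s) = d s [^]\<^bsub>G\<^esub> k" for k s
  proof (induction k)
    case (Suc k)
    have "real (Suc k) * s = real k * s + s" by (simp add: algebra_simps)
    with Suc show ?case by (simp only: add) simp
  qed (simp add: zero)
  from this[of n "t / real n"] show "c t = d t" using local[OF small] npos by simp
qed

text \<open>For fixed t the curves s \<mapsto> y(s + t) and s \<mapsto> m(y s, y t) agree at s = 0
  and solve the same equation, the second one by right invariance
  (\<open>right_inv_field_m\<close>). Uniqueness turns this into the homomorphism law.\<close>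

lemma local_one_parameter_subgroup:
  obtains r y where "r > 0" "y 0 = e" "(y has_vector_derivative \<xi>) (at 0)" "continuous_on {-r<..<r} y"
    "\<And>t. \<bar>t\<bar> < r \<Longrightarrow> y t \<in> snd \<kappa> ` fst \<kappa>"
    "\<And>s t. \<bar>s\<bar> < r \<Longrightarrow> \<bar>t\<bar> < r \<Longrightarrow> (y s, y t) \<in> m_dom \<and> y (s + t) = m (y s, y t)"
proof -
  obtain \<rho> L where \<rho>: "\<rho> > 0" "L \<ge> 0" "cball e \<rho> \<subseteq> snd \<kappa> ` fst \<kappa>"
    "\<And>y z. y \<in> cball e \<rho> \<Longrightarrow> z \<in> cball e \<rho> \<Longrightarrow>
      norm (right_inv_field \<xi> y - right_inv_field \<xi> z) \<le> L * norm (y - z)"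
    using right_inv_field_lipschitz[of \<xi>] by blast
  obtain R y where R: "R > 0" "y 0 = e" "\<And>t. \<bar>t\<bar> < R \<Longrightarrow> y t \<in> cball e \<rho>"
    "\<And>t. \<bar>t\<bar> < R \<Longrightarrow> (y has_vector_derivative right_inv_field \<xi> (y t)) (at t)"
    using picard_lindelof[OF \<rho>(1,2,4)] by metis
  have cont: "continuous_on {-R<..<R} y"
    by (intro continuous_at_imp_continuous_on ballI has_vector_derivative_continuous[OF R(4)]) auto
  have "continuous_on m_dom m" using k_smooth_on_m[of 0] by simp
  then have oN: "open (m_dom \<inter> m -` ball e \<rho>)" using open_m_dom by (auto intro: continuous_open_preimage)
  have "(e, e) \<in> m_dom \<inter> m -` ball e \<rho>" using e_m_dom[OF e_range] m_e[OF e_range] \<rho>(1) by simp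
  with oN obtain A B where AB: "open A" "open B" "e \<in> A" "e \<in> B" "A \<times> B \<subseteq> m_dom \<inter> m -` ball e \<rho>"
    by (metis open_prod_elim mem_Sigma_iff)
  have "open ({-R<..<R} \<inter> y -` (A \<inter> B))"
    using cont AB by (intro continuous_open_preimage) auto
  moreover have "0 \<in> {-R<..<R} \<inter> y -` (A \<inter> B)" using R AB by simp
  ultimately obtain r0 where r0: "r0 > 0" "ball 0 r0 \<subseteq> {-R<..<R} \<inter> y -` (A \<inter> B)"
    by (meson openE)
  \<comment> \<open>\<open>r0\<close> keeps the products y s, y t inside the chart and the Lipschitz
    ball; R / 2 keeps s + t in the interval on which \<open>y\<close> solves the equation.\<close>
  define r where "r = min r0 (R / 2)"
  have r: "r > 0" "2 * r \<le> R" using r0 R by (auto simp: r_def)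
  have AB': "y t \<in> A \<and> y t \<in> B" if "\<bar>t\<bar> < r" for t
    using r0(2) that by (auto simp: r_def subset_iff)
  then have N: "(y s, y t) \<in> m_dom \<and> m (y s, y t) \<in> cball e \<rho>" if "\<bar>s\<bar> < r" "\<bar>t\<bar> < r" for s t
    using AB(5) that by fastforce
  have "y (s + t) = m (y s, y t)" if s: "\<bar>s\<bar> < r" and t: "\<bar>t\<bar> < r" for s t
  proof (rule ode_unique[where r = r and V = "right_inv_field \<xi>" and S = "cball e \<rho>" and L = L
        and u = "\<lambda>s. y (s + t)" and v = "\<lambda>s. m (y s, y t)"])
    fix s assume s: "\<bar>s\<bar> < r"
    have st: "\<bar>s + t\<bar> < R" using s t r by linarith
    then show "y (s + t) \<in> cball e \<rho>" by (rule R(3))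
    have "((\<lambda>s. s + t) has_vector_derivative 1) (at s)" by (auto intro!: derivative_eq_intros)
    then show "((\<lambda>s. y (s + t)) has_vector_derivative right_inv_field \<xi> (y (s + t))) (at s)"
      using vector_diff_chain_at[of "\<lambda>s. s + t" 1 s y] R(4)[OF st] by (simp add: o_def)
    show "m (y s, y t) \<in> cball e \<rho>" using N s t by blast
    have D: "(y s, y t) \<in> m_dom" using N s t by blast
    have "(y has_derivative (\<lambda>h. h *\<^sub>R right_inv_field \<xi> (y s))) (at s)"
      using R(4)[of s] s r by (simp add: has_vector_derivative_def)
    from has_derivative_compose[OF this m'_left[OF D]]
    have "((\<lambda>s. m (y s, y t)) has_derivative (\<lambda>h. m' (y s, y t) (h *\<^sub>R right_inv_field \<xi> (y s), 0))) (at s)" .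
    moreover have "bounded_linear (m' (y s, y t))"
      using m_has_derivative[OF D] by (rule has_derivative_bounded_linear)
    then have "m' (y s, y t) (h *\<^sub>R right_inv_field \<xi> (y s), 0) = h *\<^sub>R m' (y s, y t) (right_inv_field \<xi> (y s), 0)" for h
      using linear_simps(5)[of "m' (y s, y t)" h "(right_inv_field \<xi> (y s), 0)"] by simp
    ultimately show "((\<lambda>s. m (y s, y t)) has_vector_derivative right_inv_field \<xi> (m (y s, y t))) (at s)"
      by (simp add: has_vector_derivative_def right_inv_field_m[OF D])
  next
    have "\<bar>t\<bar> < R" using t r by linarith
    then have "y t \<in> snd \<kappa> ` fst \<kappa>" using R(3) \<rho>(3) by blast
    then show "y (0 + t) = m (y 0, y t)" by (simp add: R(2) m_e)
  qed (use \<rho>(4) s in auto)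
  moreover have "(y has_vector_derivative \<xi>) (at 0)" using R(4)[of 0] R by (simp add: right_inv_field_e)
  moreover have "continuous_on {-r<..<r} y" using cont by (rule continuous_on_subset) (use r in auto)
  moreover have "y t \<in> snd \<kappa> ` fst \<kappa>" if "\<bar>t\<bar> < r" for t
    using N[OF that that] by (simp add: mult_chart_dom_def)
  ultimately show ?thesis using that[of r y] r R N by blast
qed

lemma one_parameter_ex: "\<exists>c. one_parameter_subgroup G \<kappa> \<xi> c"
proof -
  obtain r y where r: "r > 0" and y: "y 0 = e" "(y has_vector_derivative \<xi>) (at 0)" "continuous_on {-r<..<r} y"
    "\<And>t. \<bar>t\<bar> < r \<Longrightarrow> y t \<in> snd \<kappa> ` fst \<kappa>"
    "\<And>s t. \<bar>s\<bar> < r \<Longrightarrow> \<bar>t\<bar> < r \<Longrightarrow> (y s, y t) \<in> m_dom \<and> y (s + t) = m (y s, y t)"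
    using local_one_parameter_subgroup[of \<xi>] by blast
  define \<gamma> where "\<gamma> t = chart_inv \<kappa> (y t)" for t
  have \<gamma>: "\<gamma> t \<in> fst \<kappa>" "snd \<kappa> (\<gamma> t) = y t" if "\<bar>t\<bar> < r" for t
    using chart_inv_mem chart_of_inv y(4)[OF that] by (auto simp: \<gamma>_def)
  have "\<gamma> (s + t) = \<gamma> s \<otimes>\<^bsub>G\<^esub> \<gamma> t" if "\<bar>s\<bar> < r" "\<bar>t\<bar> < r" for s t
    using y(5)[OF that] by (auto simp: \<gamma>_def mult_chart_def mult_chart_dom_def)
  then obtain c where c: "\<And>t. c t \<in> carrier G" "\<And>s t. c (s + t) = c s \<otimes>\<^bsub>G\<^esub> c t"
    "\<And>t. \<bar>t\<bar> < r \<Longrightarrow> c t = \<gamma> t"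
    using extend_local_one_parameter_subgroup[OF r, of \<gamma>] \<gamma>(1) dom_carrier by metis
  have c0: "c 0 = \<one>\<^bsub>G\<^esub>" using c(2)[of 0 0] c(1)[of 0] by (simp add: r_cancel_one')
  have "continuous_map euclidean (lg_topology G) c"
    unfolding continuous_map_eq_topcontinuous_at topcontinuous_at_def
  proof (intro ballI conjI allI impI, goal_cases)
    case (3 t W)
    \<comment> \<open>Continuity at t is moved to the identity by left translation, since c(s) =
      c(t) c(s - t); near 0 the curve is the continuous \<open>y\<close> read through the
      chart.\<close>
    define W' where "W' = {h \<in> carrier G. c t \<otimes>\<^bsub>G\<^esub> h \<in> W}"
    have "continuous_map (lg_topology G) (lg_topology G) (\<lambda>h. c t \<otimes>\<^bsub>G\<^esub> h)"
      using c(1) by (intro lie_group_continuous_mult2[OF lie])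
        (simp_all add: lie_group_topspace[OF lie] continuous_map_id[unfolded id_def])
    then have "openin (lg_topology G) W'"
      unfolding W'_def using 3 openin_continuous_map_preimage lie_group_topspace[OF lie] by fastforce
    then have oy: "open {x \<in> snd \<kappa> ` fst \<kappa>. chart_inv \<kappa> x \<in> W'}" by (rule open_chart_inv_preimage)
    define S where "S = {-r<..<r} \<inter> y -` {x \<in> snd \<kappa> ` fst \<kappa>. chart_inv \<kappa> x \<in> W'}"
    have "open S" unfolding S_def using y(3) oy by (intro continuous_open_preimage) auto
    then have "open ((\<lambda>s. s - t) -` S)" by (intro open_vimage) (auto intro!: continuous_intros)
    moreover have "t \<in> (\<lambda>s. s - t) -` S"
      using r y(1) e_range 3 c(1)[of t] by (auto simp: S_def W'_def)
    moreover have "c s \<in> W" if "s \<in> (\<lambda>s. s - t) -` S" for s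
    proof -
      have s: "\<bar>s - t\<bar> < r" "\<gamma> (s - t) \<in> W'" using that by (auto simp: S_def \<gamma>_def)
      then have "c (t + (s - t)) \<in> W" unfolding c(2) c(3)[OF s(1)] by (simp add: W'_def)
      then show ?thesis by simp
    qed
    ultimately show ?case by (intro exI[of _ "(\<lambda>s. s - t) -` S"]) auto
  qed (use c(1) lie_group_topspace[OF lie] in auto)
  moreover have "((\<lambda>t. snd \<kappa> (c t)) has_vector_derivative \<xi>) (at 0)"
    by (rule has_vector_derivative_transform_within_open[OF y(2), of "{-r<..<r}"]) (use r c(3) \<gamma>(2) in auto)
  ultimately show ?thesis using c(2) by (auto simp: one_parameter_subgroup_def)
qed

definition flow :: "'v \<Rightarrow> real \<Rightarrow> 'g" where
  "flow \<xi> = (THE c. one_parameter_subgroup G \<kappa> \<xi> c)"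

lemma flow_eq: "one_parameter_subgroup G \<kappa> \<xi> c \<Longrightarrow> flow \<xi> = c"
  unfolding flow_def using one_parameter_unique by blast

lemma flow: "one_parameter_subgroup G \<kappa> \<xi> (flow \<xi>)"
  using one_parameter_ex flow_eq by metis

end

section \<open>Rescaling of time and the exponential map\<close>

lemma continuous_map_scale:
  "continuous_map euclidean X c \<Longrightarrow> continuous_map euclidean X (\<lambda>s. c (t * s :: real))"
  using continuous_map_compose[of euclidean euclidean "(*) t" X c]
  by (simp add: o_def continuous_intros)

lemma one_parameter_subgroup_scale:
  assumes "one_parameter_subgroup G \<kappa> \<xi> c"
  shows "one_parameter_subgroup G \<kappa> (t *\<^sub>R \<xi>) (\<lambda>s. c (t * s))"
proof -
  have "((*) t has_vector_derivative t) (at 0)" by (auto intro!: derivative_eq_intros)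
  then show ?thesis
    using assms vector_diff_chain_at[of "(*) t" t 0 "\<lambda>t. snd \<kappa> (c t)" \<xi>]
    by (simp add: one_parameter_subgroup_def continuous_map_scale distrib_left o_def)
qed

text \<open>Uniqueness is a premise here so that the same lemma serves \<open>G\<close> and the
  semidirect product, where uniqueness is proved in different ways. Rescaling time by t gives the
  subgroup with velocity t \<xi>, which is evaluated at 1.\<close>

lemma lie_exp_eq:
  assumes "\<And>\<xi> c d. one_parameter_subgroup G \<kappa> \<xi> c \<Longrightarrow> one_parameter_subgroup G \<kappa> \<xi> d \<Longrightarrow> c = d"
    and "one_parameter_subgroup G \<kappa> \<xi> c"
  shows "lie_exp G \<kappa> (t *\<^sub>R \<xi>) = c t"
proof -
  have "(THE d. one_parameter_subgroup G \<kappa> (t *\<^sub>R \<xi>) d) = (\<lambda>s. c (t * s))"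
    using one_parameter_subgroup_scale[OF assms(2)] assms(1) by blast
  then show ?thesis by (simp add: lie_exp_def)
qed

subsection \<open>The Lie bracket\<close>

context lie_chart_one
begin

interpretation group G using lie by (rule lie_group_group)

lemma
  shows flow_carrier: "flow \<xi> t \<in> carrier G"
    and flow_zero: "flow \<xi> 0 = \<one>\<^bsub>G\<^esub>"
    and flow_minus: "flow \<xi> (- t) = inv\<^bsub>G\<^esub> flow \<xi> t"
    and flow_add: "flow \<xi> (s + t) = flow \<xi> s \<otimes>\<^bsub>G\<^esub> flow \<xi> t"
    and continuous_flow: "continuous_map euclidean (lg_topology G) (flow \<xi>)"
    and flow_deriv: "((\<lambda>t. snd \<kappa> (flow \<xi> t)) has_vector_derivative \<xi>) (at 0)"
proof -
  show c: "continuous_map euclidean (lg_topology G) (flow \<xi>)"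
    and a: "flow \<xi> (s + t) = flow \<xi> s \<otimes>\<^bsub>G\<^esub> flow \<xi> t"
    and "((\<lambda>t. snd \<kappa> (flow \<xi> t)) has_vector_derivative \<xi>) (at 0)" for s t
    using flow[of \<xi>] by (auto simp: one_parameter_subgroup_def)
  show "flow \<xi> t \<in> carrier G" "flow \<xi> 0 = \<one>\<^bsub>G\<^esub>" "flow \<xi> (- t) = inv\<^bsub>G\<^esub> flow \<xi> t"
    using one_parameter_carrier[OF c a] one_parameter_zero[OF c a] one_parameter_minus[OF c a] .
qed

lemma lie_exp_flow: "lie_exp G \<kappa> (t *\<^sub>R \<xi>) = flow \<xi> t"
  using one_parameter_unique flow by (rule lie_exp_eq)

text \<open>This bridge lets a derivative along exp(t\<xi>) be read off from one derivative at
  \<open>e\<close>, where its linearity in \<xi> is evident.\<close>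

lemma vector_derivative_along_flow:
  assumes "((\<lambda>x. F (chart_inv \<kappa> x)) has_derivative F') (at e)"
  shows "((\<lambda>t. F (flow \<xi> t)) has_vector_derivative F' \<xi>) (at 0)"
proof -
  have "((\<lambda>t. snd \<kappa> (flow \<xi> t)) has_derivative (\<lambda>t. t *\<^sub>R \<xi>)) (at 0)"
    using flow_deriv by (simp add: has_vector_derivative_def)
  moreover have "((\<lambda>x. F (chart_inv \<kappa> x)) has_derivative F') (at (snd \<kappa> (flow \<xi> 0)))"
    using assms by (simp add: flow_zero)
  ultimately have "((\<lambda>t. F (chart_inv \<kappa> (snd \<kappa> (flow \<xi> t)))) has_derivative (\<lambda>t. F' (t *\<^sub>R \<xi>))) (at 0)"
    by (rule has_derivative_compose)
  then have "((\<lambda>t. F (flow \<xi> t)) has_derivative (\<lambda>t. F' (t *\<^sub>R \<xi>))) (at 0)"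
    by (rule has_derivative_transform_within_open[OF _ open_one_parameter_preimage[OF continuous_flow[of \<xi>]]])
      (use one_dom in \<open>simp_all add: flow_zero\<close>)
  moreover have "F' (t *\<^sub>R \<xi>) = t *\<^sub>R F' \<xi>" for t
    using has_derivative_bounded_linear[OF assms] by (rule linear_simps(5))
  ultimately show ?thesis by (simp add: has_vector_derivative_def)
qed

text \<open>For x near \<open>e\<close>, \<open>Ad\<close> applied to \<eta> is the partial
  derivative of \<open>conj_chart\<close> at (x, e) in its second variable. As
  \<open>conj_chart\<close> has two continuous derivatives, this can be differentiated once more in
  x.\<close>

lemma Ad_chart_differentiable:
  "(\<lambda>x. Ad G \<kappa> (chart_inv \<kappa> x) \<eta>) differentiable (at e)"
proof -
  obtain S where S: "open S" "(e, e) \<in> S" "\<And>k. k_smooth_on k S conj_chart"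
    using conj_chart_smooth[OF one_dom] by blast
  let ?K' = "\<lambda>p. frechet_derivative conj_chart (at p) (0, \<eta>)"
  let ?N = "snd \<kappa> ` fst \<kappa> \<inter> (\<lambda>x. (x, e)) -` S"
  have oN: "open ?N"
    using S(1) open_range by (intro open_Int open_vimage) (auto intro!: continuous_intros)
  have eq: "?K' (x, e) = Ad G \<kappa> (chart_inv \<kappa> x) \<eta>" if x: "x \<in> ?N" for x
  proof -
    have "(conj_chart has_derivative frechet_derivative conj_chart (at (x, e))) (at (x, e))"
      using k_smooth_on_differentiable[OF S(3)] x by blast
    then have "((\<lambda>y. conj_chart (x, y)) has_derivative (\<lambda>\<eta>. frechet_derivative conj_chart (at (x, e)) (0, \<eta>))) (at e)"
      by (intro has_derivative_compose[where f = "\<lambda>y. (x, y)" and g = conj_chart]) (auto intro!: derivative_eq_intros)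
    moreover have "((\<lambda>y. conj_chart (x, y)) has_derivative Ad G \<kappa> (chart_inv \<kappa> x)) (at e)"
      using Ad_has_derivative[of "chart_inv \<kappa> x"] x dom_carrier[OF chart_inv_mem] by (simp add: conj_chart_def)
    ultimately show ?thesis using has_derivative_unique by metis
  qed
  have "k_smooth_on (Suc 0) S ?K'"
    using S(3)[of "Suc (Suc 0)"] unfolding k_smooth_on.simps(2)[of "Suc 0"] by blast
  then have "?K' differentiable (at (e, e))" using S(2) by simp
  moreover have "(\<lambda>x. (x, e)) differentiable (at e)" by (intro differentiable_Pair) auto
  ultimately obtain D where D: "((\<lambda>x. ?K' (x, e)) has_derivative D) (at e)"
    using differentiable_chain_at[of "\<lambda>x. (x, e)" e ?K'] by (auto simp: o_def differentiable_def)
  have "((\<lambda>x. Ad G \<kappa> (chart_inv \<kappa> x) \<eta>) has_derivative D) (at e)"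
  proof (rule has_derivative_transform_within_open[OF D oN])
    show "e \<in> ?N" using S(2) e_range by simp
  qed (rule eq)
  then show ?thesis by (rule differentiableI)
qed

lemma Ad_chart_has_derivative:
  "((\<lambda>x. Ad G \<kappa> (chart_inv \<kappa> x) \<eta>) has_derivative (\<lambda>\<xi>. lie_bracket G \<kappa> \<xi> \<eta>)) (at e)"
proof -
  obtain D where D: "((\<lambda>x. Ad G \<kappa> (chart_inv \<kappa> x) \<eta>) has_derivative D) (at e)"
    using Ad_chart_differentiable by (auto simp: differentiable_def)
  have "lie_bracket G \<kappa> \<xi> \<eta> = D \<xi>" for \<xi>
    unfolding lie_bracket_def lie_exp_flow
    using vector_derivative_along_flow[OF D] by (rule vector_derivative_at)
  with D show ?thesis by simp
qed

lemma Ad_flow_deriv: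
  "((\<lambda>t. Ad G \<kappa> (flow \<xi> t) \<eta>) has_vector_derivative lie_bracket G \<kappa> \<xi> \<eta>) (at 0)"
  using vector_derivative_along_flow[OF Ad_chart_has_derivative] .

text \<open>Linearity in the second argument is inherited from each \<open>Ad\<close>; linearity in
  the first holds because the bracket is a derivative evaluated at \<xi>. Boundedness is then
  automatic in finite dimension.\<close>

lemma bounded_bilinear_lie_bracket: "bounded_bilinear (lie_bracket G \<kappa>)"
proof -
  have A: "bounded_linear (Ad G \<kappa> (flow \<xi> t))" for \<xi> t by (rule bounded_linear_Ad[OF flow_carrier])
  have "linear (lie_bracket G \<kappa> \<xi>)" for \<xi>
  proof (rule linearI)
    show "lie_bracket G \<kappa> \<xi> (x + y) = lie_bracket G \<kappa> \<xi> x + lie_bracket G \<kappa> \<xi> y" for x y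
      using has_vector_derivative_add[OF Ad_flow_deriv Ad_flow_deriv, of \<xi> x \<xi> y]
      unfolding linear_simps(1)[OF A, symmetric] by (rule vector_derivative_unique_at[OF Ad_flow_deriv])
    show "lie_bracket G \<kappa> \<xi> (r *\<^sub>R x) = r *\<^sub>R lie_bracket G \<kappa> \<xi> x" for r x
      using bounded_linear.has_vector_derivative[OF bounded_linear_scaleR_right Ad_flow_deriv, of r \<xi> x]
      unfolding linear_simps(5)[OF A, symmetric] by (rule vector_derivative_unique_at[OF Ad_flow_deriv])
  qed
  moreover have "linear (\<lambda>\<xi>. lie_bracket G \<kappa> \<xi> \<eta>)" for \<eta>
    using has_derivative_linear[OF Ad_chart_has_derivative] .
  ultimately show ?thesis unfolding bilinear_conv_bounded_bilinear[symmetric] by (simp add: bilinear_def)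
qed

text \<open>\<open>Ad\<close> fixes \<open>\<xi>\<close> along its own one-parameter subgroup, so the bracket is alternating.\<close>

lemma Ad_flow_self: "Ad G \<kappa> (flow \<xi> t) \<xi> = \<xi>"
proof -
  let ?c = "flow \<xi>" and ?g = "flow \<xi> t"
  have "((\<lambda>s. snd \<kappa> (inv\<^bsub>G\<^esub> ?g \<otimes>\<^bsub>G\<^esub> ?c s \<otimes>\<^bsub>G\<^esub> ?g)) has_vector_derivative Ad G \<kappa> ?g \<xi>) (at 0)"
    using vector_derivative_along_flow[OF Ad_has_derivative[OF flow_carrier]] .
  moreover have "inv\<^bsub>G\<^esub> ?g \<otimes>\<^bsub>G\<^esub> ?c s \<otimes>\<^bsub>G\<^esub> ?g = ?c s" for s
    unfolding flow_minus[symmetric] flow_add[symmetric] by simp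
  ultimately have "((\<lambda>s. snd \<kappa> (?c s)) has_vector_derivative Ad G \<kappa> ?g \<xi>) (at 0)" by simp
  then show ?thesis using flow_deriv by (rule vector_derivative_unique_at)
qed

lemma lie_bracket_antisym: "lie_bracket G \<kappa> \<xi> \<eta> = - lie_bracket G \<kappa> \<eta> \<xi>"
proof -
  interpret B: bounded_bilinear "lie_bracket G \<kappa>" by (rule bounded_bilinear_lie_bracket)
  have 0: "lie_bracket G \<kappa> \<xi> \<xi> = 0" for \<xi>
    using Ad_flow_deriv[of \<xi> \<xi>] unfolding Ad_flow_self
    by (rule vector_derivative_unique_at) (rule has_vector_derivative_const)
  have "lie_bracket G \<kappa> \<xi> \<eta> + lie_bracket G \<kappa> \<eta> \<xi> = 0"
    using 0[of "\<xi> + \<eta>"] unfolding B.add_left B.add_right by (simp add: 0 add.commute)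
  then show ?thesis by (simp add: eq_neg_iff_add_eq_0)
qed

text \<open>\<open>Blinfun\<close> returns the intended functional once its argument is known to be
  bounded and linear, which bilinearity of the bracket provides.\<close>

lemma ad_star_apply: "blinfun_apply (ad_star G \<kappa> \<xi> \<mu>) \<eta> = blinfun_apply \<mu> (lie_bracket G \<kappa> \<xi> \<eta>)"
  unfolding ad_star_def
  by (simp add: bounded_linear_Blinfun_apply bounded_linear_compose[OF _ bounded_bilinear.bounded_linear_right[OF bounded_bilinear_lie_bracket]]
      blinfun.bounded_linear_right)

lemma bounded_bilinear_ad_star: "bounded_bilinear (ad_star G \<kappa>)"
proof -
  interpret B: bounded_bilinear "lie_bracket G \<kappa>" by (rule bounded_bilinear_lie_bracket)
  obtain K where K: "0 < K" "\<And>x y. norm (lie_bracket G \<kappa> x y) \<le> norm x * norm y * K"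
    using B.pos_bounded by blast
  show ?thesis
  proof
    have "norm (ad_star G \<kappa> x \<mu>) \<le> norm x * norm \<mu> * K" for x \<mu>
    proof (rule norm_blinfun_bound)
      show "norm (blinfun_apply (ad_star G \<kappa> x \<mu>) y) \<le> norm x * norm \<mu> * K * norm y" for y
        unfolding ad_star_apply
        using order_trans[OF norm_blinfun mult_left_mono[OF K(2)[of x y] norm_ge_zero[of \<mu>]]]
        by (simp add: mult_ac)
    qed (use K(1) in simp)
    then show "\<exists>K. \<forall>a b. norm (ad_star G \<kappa> a b) \<le> norm a * norm b * K" by blast
  qed (auto intro!: blinfun_eqI simp: ad_star_apply blinfun.bilinear_simps B.add_left B.scaleR_left)
qed

end

section \<open>Calculus in the dual space by coordinates in the dual basis\<close>

lemma blinfun_real_expansion: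
  fixes \<nu> :: "'v::euclidean_space \<Rightarrow>\<^sub>L real"
  shows "(\<Sum>b\<in>Basis. blinfun_apply \<nu> b *\<^sub>R blinfun_inner_left b) = \<nu>"
  by (rule blinfun_euclidean_eqI)
    (simp add: blinfun.sum_left blinfun.scaleR_left inner_Basis if_distrib cong: if_cong)

text \<open>In finite dimension, differentiability in the operator norm can be tested on basis
  vectors, since the functional is a finite combination of fixed dual basis elements with these
  values as coefficients.\<close>

lemma has_derivative_blinfunI:
  fixes f :: "'a::real_normed_vector \<Rightarrow> 'v::euclidean_space \<Rightarrow>\<^sub>L real"
  assumes "\<And>b. b \<in> Basis \<Longrightarrow> ((\<lambda>x. blinfun_apply (f x) b) has_derivative (\<lambda>h. blinfun_apply (f' h) b)) F"
  shows "(f has_derivative f') F"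
proof -
  have "((\<lambda>x. \<Sum>b\<in>Basis. blinfun_apply (f x) b *\<^sub>R blinfun_inner_left b) has_derivative
      (\<lambda>h. \<Sum>b\<in>Basis. blinfun_apply (f' h) b *\<^sub>R blinfun_inner_left b)) F"
    by (intro has_derivative_sum has_derivative_scaleR_left assms)
  then show ?thesis by (simp add: blinfun_real_expansion)
qed

lemma has_vector_derivative_blinfunI:
  fixes f :: "real \<Rightarrow> 'v::euclidean_space \<Rightarrow>\<^sub>L real"
  assumes "\<And>b. b \<in> Basis \<Longrightarrow> ((\<lambda>x. blinfun_apply (f x) b) has_vector_derivative blinfun_apply f' b) F"
  shows "(f has_vector_derivative f') F"
  using assms unfolding has_vector_derivative_def
  by (intro has_derivative_blinfunI) (simp add: blinfun.scaleR_left)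

text \<open>This supplies the second component of the one-parameter subgroups of the semidirect
  product. Each coordinate is integrated separately and shifted to vanish at 0.\<close>

lemma blinfun_antiderivative_ex:
  fixes a :: "real \<Rightarrow> 'v::euclidean_space \<Rightarrow>\<^sub>L real"
  assumes "continuous_on UNIV a"
  obtains n where "n 0 = 0" "\<And>t. (n has_vector_derivative a t) (at t)"
proof -
  have "\<exists>F. \<forall>t. (F has_vector_derivative blinfun_apply (a t) b) (at t)" for b
    using einterval_antiderivative[of "-\<infinity>" "\<infinity>" "\<lambda>t. blinfun_apply (a t) b"]
      bounded_linear.continuous_on[OF blinfun.bounded_linear_left assms, of b]
    by (simp add: continuous_on_eq_continuous_at)
  then obtain N where N: "\<And>b t. (N b has_vector_derivative blinfun_apply (a t) b) (at t)" by metis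
  define n where "n t = (\<Sum>b\<in>Basis. (N b t - N b 0) *\<^sub>R blinfun_inner_left b)" for t
  have nb: "blinfun_apply (n t) b = N b t - N b 0" if "b \<in> Basis" for t and b :: 'v
    using that by (simp add: n_def blinfun.sum_left blinfun.scaleR_left inner_Basis if_distrib cong: if_cong)
  show ?thesis
  proof (rule that)
    show "n 0 = 0" by (simp add: n_def)
    show "(n has_vector_derivative a t) (at t)" for t
    proof (rule has_vector_derivative_blinfunI)
      fix b :: 'v assume b: "b \<in> Basis"
      have "((\<lambda>t. N b t - N b 0) has_vector_derivative blinfun_apply (a t) b - 0) (at t)"
        by (intro has_vector_derivative_diff N has_vector_derivative_const)
      then show "((\<lambda>t. blinfun_apply (n t) b) has_vector_derivative blinfun_apply (a t) b) (at t)"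
        by (simp add: nb[OF b])
    qed
  qed
qed

section \<open>The Lie algebra of the semidirect product\<close>

context lie_chart_one
begin

interpretation group G using lie by (rule lie_group_group)

abbreviation SG where "SG \<equiv> semidirect G \<kappa>"
abbreviation S\<kappa> where "S\<kappa> \<equiv> semidirect_chart \<kappa>"

text \<open>The left action \<open>Ad\<^sup>*\<close> at \<open>g\<inverse>\<close>, that is \<open>\<nu> \<mapsto> \<nu> \<circ> Ad\<^sub>g\<close>.\<close>

abbreviation coact where "coact g \<equiv> Ad_star G \<kappa> (inv\<^bsub>G\<^esub> g)"

lemma coact_apply: "g \<in> carrier G \<Longrightarrow> blinfun_apply (coact g \<nu>) \<eta> = blinfun_apply \<nu> (Ad G \<kappa> g \<eta>)"
  unfolding Ad_star_def
  by (simp add: bounded_linear_Blinfun_apply bounded_linear_compose[OF blinfun.bounded_linear_right bounded_linear_Ad])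

text \<open>\<open>Ad\<close> reverses products and precomposition reverses them again, so this is a
  left action; associativity of the semidirect product rests on it.\<close>

lemma coact_mult:
  assumes "g \<in> carrier G" "h \<in> carrier G"
  shows "coact (g \<otimes>\<^bsub>G\<^esub> h) \<nu> = coact g (coact h \<nu>)"
  by (rule blinfun_eqI) (simp only: coact_apply assms m_closed Ad_mult o_def)

lemma coact_one: "coact \<one>\<^bsub>G\<^esub> \<nu> = \<nu>"
  by (rule blinfun_eqI) (simp only: coact_apply one_closed Ad_one id_def)

lemma bounded_linear_coact:
  assumes g: "g \<in> carrier G"
  shows "bounded_linear (coact g)"
proof -
  obtain K where K: "\<And>x. norm (Ad G \<kappa> g x) \<le> norm x * K" "0 \<le> K"
    using bounded_linear.nonneg_bounded[OF bounded_linear_Ad[OF g]] by blast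
  have "norm (coact g \<nu>) \<le> norm \<nu> * K" for \<nu>
  proof (rule norm_blinfun_bound)
    show "norm (blinfun_apply (coact g \<nu>) x) \<le> norm \<nu> * K * norm x" for x
      unfolding coact_apply[OF g]
      using order_trans[OF norm_blinfun mult_left_mono[OF K(1)[of x] norm_ge_zero[of \<nu>]]] by (simp add: mult_ac)
  qed (use K in simp)
  then show ?thesis
    by (intro bounded_linear_intro[where K = K] blinfun_eqI) (auto simp: coact_apply[OF g] blinfun.bilinear_simps)
qed

lemma coact_chart_has_derivative:
  "((\<lambda>x. coact (chart_inv \<kappa> x) \<mu>) has_derivative (\<lambda>\<eta>. ad_star G \<kappa> \<eta> \<mu>)) (at e)"
proof (rule has_derivative_blinfunI)
  fix b
  have "((\<lambda>x. blinfun_apply \<mu> (Ad G \<kappa> (chart_inv \<kappa> x) b)) has_derivative (\<lambda>\<eta>. blinfun_apply (ad_star G \<kappa> \<eta> \<mu>) b)) (at e)"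
    unfolding ad_star_apply by (rule bounded_linear.has_derivative[OF blinfun.bounded_linear_right Ad_chart_has_derivative])
  then show "((\<lambda>x. blinfun_apply (coact (chart_inv \<kappa> x) \<mu>) b) has_derivative (\<lambda>\<eta>. blinfun_apply (ad_star G \<kappa> \<eta> \<mu>) b)) (at e)"
    by (rule has_derivative_transform_within_open[OF _ open_range e_range])
      (simp only: coact_apply dom_carrier[OF chart_inv_mem])
qed

lemma semidirect_simps:
  "carrier SG = carrier G \<times> UNIV"
  "(g, \<mu>) \<otimes>\<^bsub>SG\<^esub> (h, \<nu>) = (g \<otimes>\<^bsub>G\<^esub> h, \<mu> + coact g \<nu>)"
  "\<one>\<^bsub>SG\<^esub> = (\<one>\<^bsub>G\<^esub>, 0)"
  "lg_topology SG = prod_topology (lg_topology G) euclidean"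
  by (simp_all add: semidirect_def)

lemma group_semidirect: "group SG"
proof (rule groupI)
  show "\<exists>y\<in>carrier SG. y \<otimes>\<^bsub>SG\<^esub> x = \<one>\<^bsub>SG\<^esub>" if "x \<in> carrier SG" for x
  proof (cases x)
    case (Pair g \<mu>)
    then show ?thesis using that
      by (intro bexI[of _ "(inv\<^bsub>G\<^esub> g, - coact (inv\<^bsub>G\<^esub> g) \<mu>)"]) (auto simp: semidirect_simps)
  qed
qed (auto simp: semidirect_simps m_assoc coact_mult coact_one linear_simps(1)[OF bounded_linear_coact] add.assoc
    simp del: inv_one)

lemma inv_semidirect:
  assumes "g \<in> carrier G"
  shows "inv\<^bsub>SG\<^esub> (g, \<mu>) = (inv\<^bsub>G\<^esub> g, - coact (inv\<^bsub>G\<^esub> g) \<mu>)"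
  by (rule group.inv_equality[OF group_semidirect]) (use assms in \<open>simp_all add: semidirect_simps del: inv_inv\<close>)

lemma semidirect_chart_simps:
  "fst S\<kappa> = fst \<kappa> \<times> UNIV" "snd S\<kappa> (g, \<mu>) = (snd \<kappa> g, \<mu>)"
  by (simp_all add: semidirect_chart_def prod_chart_def)

lemma semidirect_chart_inv:
  assumes "x \<in> snd \<kappa> ` fst \<kappa>"
  shows "chart_inv S\<kappa> (x, \<mu>) = (chart_inv \<kappa> x, \<mu>)"
proof (rule inv_into_f_eq)
  show "inj_on (snd S\<kappa>) (fst S\<kappa>)"
    using map_prod_inj_on[OF inj_chart inj_on_id[of UNIV]] by (simp add: semidirect_chart_def prod_chart_def)
qed (use assms chart_inv_mem chart_of_inv in \<open>auto simp: semidirect_chart_simps\<close>)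

text \<open>Multiplying out the conjugate of (x, \<nu>) gives the second component
  \<open>coact\<close> at g\<inverse> of \<nu> + coact x \<mu> - \<mu>, which is \<open>?F\<close>.
  Differentiating at (e, 0), only \<open>coact x \<mu>\<close> depends on x, and it contributes the
  term with \<open>ad_star\<close>.\<close>

lemma Ad_semidirect:
  assumes g: "g \<in> carrier G"
  shows "Ad SG S\<kappa> (g, \<mu>) = (\<lambda>(\<eta>, \<rho>). (Ad G \<kappa> g \<eta>, coact (inv\<^bsub>G\<^esub> g) (\<rho> + ad_star G \<kappa> \<eta> \<mu>)))"
proof -
  let ?F = "\<lambda>p. (snd \<kappa> (inv\<^bsub>G\<^esub> g \<otimes>\<^bsub>G\<^esub> chart_inv \<kappa> (fst p) \<otimes>\<^bsub>G\<^esub> g),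
      coact (inv\<^bsub>G\<^esub> g) (snd p + coact (chart_inv \<kappa> (fst p)) \<mu> - \<mu>))"
  let ?F' = "\<lambda>(\<eta>, \<rho>). (Ad G \<kappa> g \<eta>, coact (inv\<^bsub>G\<^esub> g) (\<rho> + ad_star G \<kappa> \<eta> \<mu>))"
  let ?C = "snd S\<kappa> \<circ> (\<lambda>h. inv\<^bsub>SG\<^esub> (g, \<mu>) \<otimes>\<^bsub>SG\<^esub> h \<otimes>\<^bsub>SG\<^esub> (g, \<mu>)) \<circ> chart_inv S\<kappa>"
  interpret C: bounded_linear "coact (inv\<^bsub>G\<^esub> g)" by (rule bounded_linear_coact[OF inv_closed[OF g]])
  have f: "(fst has_derivative fst) (at (e, 0))" "(snd has_derivative snd) (at (e, 0))"
    by (auto intro: bounded_linear_imp_has_derivative bounded_linear_fst bounded_linear_snd)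
  have 1: "((\<lambda>p. snd \<kappa> (inv\<^bsub>G\<^esub> g \<otimes>\<^bsub>G\<^esub> chart_inv \<kappa> (fst p) \<otimes>\<^bsub>G\<^esub> g)) has_derivative (\<lambda>h. Ad G \<kappa> g (fst h))) (at (e, 0))"
    using has_derivative_compose[OF f(1)] Ad_has_derivative[OF g] by simp
  have 2: "((\<lambda>p. coact (chart_inv \<kappa> (fst p)) \<mu>) has_derivative (\<lambda>h. ad_star G \<kappa> (fst h) \<mu>)) (at (e, 0))"
    by (rule has_derivative_compose[OF f(1), unfolded fst_conv, OF coact_chart_has_derivative])
  have "(?F has_derivative (\<lambda>h. (Ad G \<kappa> g (fst h), coact (inv\<^bsub>G\<^esub> g) (snd h + ad_star G \<kappa> (fst h) \<mu> - 0)))) (at (e, 0))"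
    by (intro has_derivative_Pair 1 C.has_derivative has_derivative_diff has_derivative_add f(2) 2 has_derivative_const)
  then have "(?F has_derivative ?F') (at (e, 0))" by (simp add: case_prod_beta')
  then have "(?C has_derivative ?F') (at (e, 0))"
  proof (rule has_derivative_transform_within_open)
    show "open ((snd \<kappa> ` fst \<kappa>) \<times> (UNIV :: ('v \<Rightarrow>\<^sub>L real) set))" using open_range by (intro open_Times) auto
    show "(e, 0) \<in> (snd \<kappa> ` fst \<kappa>) \<times> (UNIV :: ('v \<Rightarrow>\<^sub>L real) set)" using e_range by simp
    fix p :: "'v \<times> ('v \<Rightarrow>\<^sub>L real)" assume p: "p \<in> (snd \<kappa> ` fst \<kappa>) \<times> UNIV"
    obtain x \<nu> where [simp]: "p = (x, \<nu>)" by (cases p)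
    have x: "x \<in> snd \<kappa> ` fst \<kappa>" using p by simp
    have c: "chart_inv \<kappa> x \<in> carrier G" by (rule dom_carrier[OF chart_inv_mem[OF x]])
    have "coact (inv\<^bsub>G\<^esub> g) (\<nu> + coact (chart_inv \<kappa> x) \<mu> - \<mu>) =
        - coact (inv\<^bsub>G\<^esub> g) \<mu> + coact (inv\<^bsub>G\<^esub> g) \<nu> + coact (inv\<^bsub>G\<^esub> g \<otimes>\<^bsub>G\<^esub> chart_inv \<kappa> x) \<mu>"
      unfolding coact_mult[OF inv_closed[OF g] c] C.add C.diff by (rule diff_conv_add_uminus[THEN trans]) (simp only: ac_simps)
    then show "?F p = ?C p"
      by (simp only: o_def semidirect_chart_inv[OF x] inv_semidirect[OF g] semidirect_simps semidirect_chart_simps(2)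
          \<open>p = (x, \<nu>)\<close> fst_conv snd_conv)
  qed
  then have "?F' = frechet_derivative ?C (at (e, 0))" by (rule frechet_derivative_at)
  then show ?thesis by (simp add: Ad_def semidirect_simps semidirect_chart_simps)
qed

text \<open>The derivative at t follows from the one at 0 by splitting off the factor flow t on the
  left. It yields the continuity that makes this curve integrable.\<close>

lemma coact_flow_has_vector_derivative:
  "((\<lambda>s. coact (flow \<xi> s) \<mu>) has_vector_derivative coact (flow \<xi> t) (ad_star G \<kappa> \<xi> \<mu>)) (at t)"
proof -
  have "((\<lambda>s. coact (flow \<xi> s) \<mu>) has_vector_derivative ad_star G \<kappa> \<xi> \<mu>) (at 0)"
    using vector_derivative_along_flow[OF coact_chart_has_derivative] .
  then have "((\<lambda>s. coact (flow \<xi> t) (coact (flow \<xi> s) \<mu>)) has_vector_derivative coact (flow \<xi> t) (ad_star G \<kappa> \<xi> \<mu>)) (at (t - t))"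
    using bounded_linear.has_vector_derivative[OF bounded_linear_coact[OF flow_carrier]] by simp
  moreover have "((\<lambda>s. s - t) has_vector_derivative 1) (at t)"
    by (auto intro!: derivative_eq_intros)
  moreover have "coact (flow \<xi> t) (coact (flow \<xi> (s - t)) \<mu>) = coact (flow \<xi> s) \<mu>" for s
    unfolding coact_mult[OF flow_carrier flow_carrier, symmetric] flow_add[symmetric] by simp
  ultimately show ?thesis
    using vector_diff_chain_at[of "\<lambda>s. s - t" 1 t "\<lambda>s. coact (flow \<xi> t) (coact (flow \<xi> s) \<mu>)"]
    by (simp only: o_def scaleR_one)
qed

text \<open>The homomorphism law for the second component n is the cocycle identity n(s + t) = n(s)
  + coact(c(s)) (n(t)). Differentiating it in t at 0 gives the equation for n; conversely the
  equation, with n(0) = 0, forces the identity.\<close>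

lemma one_parameter_subgroup_semidirect:
  "one_parameter_subgroup SG S\<kappa> (\<xi>, \<mu>) p \<longleftrightarrow>
     (\<forall>t. fst (p t) = flow \<xi> t) \<and> snd (p 0) = 0 \<and>
     (\<forall>t. ((\<lambda>t. snd (p t)) has_vector_derivative coact (flow \<xi> t) \<mu>) (at t))"
  (is "?L = ?R")
proof
  assume L: ?L
  have cont: "continuous_map euclidean (lg_topology G) (\<lambda>t. fst (p t))"
    and add: "\<And>s t. p (s + t) = p s \<otimes>\<^bsub>SG\<^esub> p t"
    and d: "((\<lambda>t. snd S\<kappa> (p t)) has_vector_derivative (\<xi>, \<mu>)) (at 0)"
    using L by (simp_all add: one_parameter_subgroup_def semidirect_simps continuous_map_pairwise o_def)
  have add1: "fst (p (s + t)) = fst (p s) \<otimes>\<^bsub>G\<^esub> fst (p t)"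
    and add2: "snd (p (s + t)) = snd (p s) + coact (fst (p s)) (snd (p t))" for s t
    unfolding add by (cases "p s"; cases "p t"; simp add: semidirect_simps)+
  have S\<kappa>: "snd S\<kappa> q = (snd \<kappa> (fst q), snd q)" for q by (cases q) (simp add: semidirect_chart_simps)
  have d1: "((\<lambda>t. snd \<kappa> (fst (p t))) has_vector_derivative \<xi>) (at 0)"
    and d2: "((\<lambda>t. snd (p t)) has_vector_derivative \<mu>) (at 0)"
    using bounded_linear.has_vector_derivative[OF bounded_linear_fst d]
      bounded_linear.has_vector_derivative[OF bounded_linear_snd d] by (simp_all add: S\<kappa>)
  have "flow \<xi> = (\<lambda>t. fst (p t))"
    by (rule flow_eq) (use cont add1 d1 in \<open>simp add: one_parameter_subgroup_def\<close>)
  then have c: "fst (p t) = flow \<xi> t" for t by (metis)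
  have 0: "snd (p 0) = 0"
    using add2[of 0 0] coact_one by (simp add: c flow_zero del: inv_one)
  have "((\<lambda>s. snd (p s)) has_vector_derivative coact (flow \<xi> t) \<mu>) (at t)" for t
  proof -
    have "((\<lambda>s. snd (p t) + coact (flow \<xi> t) (snd (p s))) has_vector_derivative 0 + coact (flow \<xi> t) \<mu>) (at (t - t))"
      using bounded_linear.has_vector_derivative[OF bounded_linear_coact[OF flow_carrier] d2]
      by (intro has_vector_derivative_add has_vector_derivative_const) simp
    moreover have "((\<lambda>s. s - t) has_vector_derivative 1) (at t)"
      by (auto intro!: derivative_eq_intros)
    moreover have "snd (p t) + coact (flow \<xi> t) (snd (p (s - t))) = snd (p s)" for s
      using add2[of t "s - t"] by (simp add: c)
    ultimately show ?thesis
      using vector_diff_chain_at[of "\<lambda>s. s - t" 1 t "\<lambda>s. snd (p t) + coact (flow \<xi> t) (snd (p s))"]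
      by (simp only: o_def scaleR_one add_0)
  qed
  with c 0 show ?R by blast
next
  assume R: ?R
  define n where "n t = snd (p t)" for t
  have p: "p t = (flow \<xi> t, n t)" for t using R by (simp add: prod_eq_iff n_def)
  have n0: "n 0 = 0" and n: "\<And>t. (n has_vector_derivative coact (flow \<xi> t) \<mu>) (at t)"
    using R by (simp_all add: n_def[abs_def])
  \<comment> \<open>The defect of the cocycle identity, as a function of t, has derivative zero
    because \<open>coact\<close> is multiplicative along the flow, and it vanishes at t = 0.\<close>
  have add: "n (s + t) = n s + coact (flow \<xi> s) (n t)" for s t
  proof -
    let ?h = "\<lambda>t. n (s + t) - n s - coact (flow \<xi> s) (n t)"
    have "(?h has_vector_derivative 0) (at t)" for t
    proof -
      have "((+) s has_vector_derivative 1) (at t)" by (auto intro!: derivative_eq_intros)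
      then have 1: "((\<lambda>t. n (s + t)) has_vector_derivative coact (flow \<xi> (s + t)) \<mu>) (at t)"
        using vector_diff_chain_at[of "(+) s" 1 t n] n[of "s + t"] by (simp only: o_def scaleR_one)
      have "(?h has_vector_derivative coact (flow \<xi> (s + t)) \<mu> - 0 - coact (flow \<xi> s) (coact (flow \<xi> t) \<mu>)) (at t)"
        by (intro has_vector_derivative_diff 1 has_vector_derivative_const
            bounded_linear.has_vector_derivative[OF bounded_linear_coact[OF flow_carrier]] n)
      then show ?thesis by (simp only: flow_add coact_mult flow_carrier diff_self diff_zero)
    qed
    then obtain k where k: "\<And>t. ?h t = k"
      using has_vector_derivative_zero_constant[of UNIV ?h] by auto
    have "k = 0" using k[of 0] n0 linear_simps(3)[OF bounded_linear_coact[OF flow_carrier]] by simp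
    with k[of t] show ?thesis by (simp add: algebra_simps)
  qed
  have "continuous_on UNIV n"
    by (intro continuous_at_imp_continuous_on ballI has_vector_derivative_continuous[OF n])
  then have "continuous_map euclidean (lg_topology SG) p"
    using continuous_flow by (simp add: semidirect_simps continuous_map_pairwise o_def p)
  moreover have "p (s + t) = p s \<otimes>\<^bsub>SG\<^esub> p t" for s t
    by (simp only: p semidirect_simps add flow_add)
  moreover have "((\<lambda>t. snd S\<kappa> (p t)) has_vector_derivative (\<xi>, \<mu>)) (at 0)"
    using has_vector_derivative_Pair[OF flow_deriv[of \<xi>] n[of 0]] coact_one
    by (simp only: p semidirect_chart_simps flow_zero)
  ultimately show ?L by (simp add: one_parameter_subgroup_def)
qed

lemma one_parameter_semidirect_unique:
  assumes "one_parameter_subgroup SG S\<kappa> \<alpha> p" "one_parameter_subgroup SG S\<kappa> \<alpha> q"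
  shows "p = q"
proof (rule ext)
  fix t
  obtain \<xi> \<mu> where \<alpha>: "\<alpha> = (\<xi>, \<mu>)" by (cases \<alpha>)
  note pq = assms[unfolded \<alpha> one_parameter_subgroup_semidirect]
  have "((\<lambda>t. snd (p t) - snd (q t)) has_vector_derivative 0) (at t)" for t
    using has_vector_derivative_diff[of "\<lambda>t. snd (p t)" "coact (flow \<xi> t) \<mu>" "at t" "\<lambda>t. snd (q t)" "coact (flow \<xi> t) \<mu>"] pq
    by simp
  then obtain k where "\<And>t. snd (p t) - snd (q t) = k"
    using has_vector_derivative_zero_constant[of UNIV "\<lambda>t. snd (p t) - snd (q t)"] by auto
  then have "snd (p t) - snd (q t) = snd (p 0) - snd (q 0)" by metis
  then show "p t = q t" using pq by (simp add: prod_eq_iff)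
qed

lemma lie_bracket_semidirect:
  "lie_bracket SG S\<kappa> (\<xi>, \<mu>) (\<eta>, \<rho>) =
    (lie_bracket G \<kappa> \<xi> \<eta>, ad_star G \<kappa> \<eta> \<mu> - ad_star G \<kappa> \<xi> \<rho>)"
proof -
  have "continuous_on UNIV (\<lambda>t. coact (flow \<xi> t) \<mu>)"
    by (intro continuous_at_imp_continuous_on ballI has_vector_derivative_continuous[OF coact_flow_has_vector_derivative])
  then obtain n where n: "n 0 = 0" "\<And>t. (n has_vector_derivative coact (flow \<xi> t) \<mu>) (at t)"
    using blinfun_antiderivative_ex by blast
  have "one_parameter_subgroup SG S\<kappa> (\<xi>, \<mu>) (\<lambda>t. (flow \<xi> t, n t))"
    using n by (simp add: one_parameter_subgroup_semidirect)
  then have exp: "lie_exp SG S\<kappa> (t *\<^sub>R (\<xi>, \<mu>)) = (flow \<xi> t, n t)" for t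
    using one_parameter_semidirect_unique by (rule lie_exp_eq[rotated])
  let ?f = "\<lambda>t. coact (flow \<xi> (- t)) (\<rho> + ad_star G \<kappa> \<eta> (n t))"
  have Ad: "Ad SG S\<kappa> (flow \<xi> t, n t) (\<eta>, \<rho>) = (Ad G \<kappa> (flow \<xi> t) \<eta>, ?f t)" for t
    by (simp only: Ad_semidirect[OF flow_carrier] flow_minus case_prod_conv)
  have n': "(n has_vector_derivative \<mu>) (at 0)"
    using n(2)[of 0] by (simp only: flow_zero coact_one)
  have u: "((\<lambda>t. \<rho> + ad_star G \<kappa> \<eta> (n t)) has_vector_derivative 0 + ad_star G \<kappa> \<eta> \<mu>) (at 0)"
    by (intro has_vector_derivative_add has_vector_derivative_const n'
        bounded_linear.has_vector_derivative[OF bounded_bilinear.bounded_linear_right[OF bounded_bilinear_ad_star]])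
  have u0: "ad_star G \<kappa> \<eta> (n 0) = 0"
    unfolding n(1) by (rule bounded_bilinear.zero_right[OF bounded_bilinear_ad_star])
  \<comment> \<open>Evaluated at b, the curve pairs \<rho> + ad_star \<eta> (n t) with
    \<open>Ad\<close> at exp(-t\<xi>) of b. In the product rule n' = \<mu> at 0 gives the first
    term, the inverse gives the minus sign of the second, and n(0) = 0 removes the cross
    term.\<close>
  have f: "(?f has_vector_derivative ad_star G \<kappa> \<eta> \<mu> - ad_star G \<kappa> \<xi> \<rho>) (at 0)"
  proof (rule has_vector_derivative_blinfunI)
    fix b
    let ?w = "\<lambda>t. Ad G \<kappa> (flow \<xi> (- t)) b"
    have "(uminus has_vector_derivative - 1) (at (0::real))" by (auto intro!: derivative_eq_intros)
    then have w: "(?w has_vector_derivative - lie_bracket G \<kappa> \<xi> b) (at 0)"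
      using vector_diff_chain_at[of uminus "- 1" 0 "\<lambda>t. Ad G \<kappa> (flow \<xi> t) b"] Ad_flow_deriv[of \<xi> b] by (simp add: o_def)
    have "((\<lambda>t. blinfun_apply (\<rho> + ad_star G \<kappa> \<eta> (n t)) (?w t)) has_vector_derivative
        blinfun_apply (\<rho> + ad_star G \<kappa> \<eta> (n 0)) (- lie_bracket G \<kappa> \<xi> b) + blinfun_apply (0 + ad_star G \<kappa> \<eta> \<mu>) (?w 0)) (at 0)"
      by (rule bounded_bilinear.has_vector_derivative[OF bounded_bilinear_blinfun_apply u w])
    moreover have "?w 0 = b" by (simp add: flow_zero Ad_one)
    moreover have "blinfun_apply (\<rho> + ad_star G \<kappa> \<eta> (n t)) (?w t) = blinfun_apply (?f t) b" for t
      by (simp only: coact_apply flow_carrier)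
    ultimately show "((\<lambda>t. blinfun_apply (?f t) b) has_vector_derivative blinfun_apply (ad_star G \<kappa> \<eta> \<mu> - ad_star G \<kappa> \<xi> \<rho>) b) (at 0)"
      by (simp add: u0 blinfun.bilinear_simps ad_star_apply)
  qed
  show ?thesis
    unfolding lie_bracket_def[of SG] exp Ad
    by (rule vector_derivative_at[OF has_vector_derivative_Pair[OF Ad_flow_deriv f]])
qed

end

section \<open>Functional derivatives\<close>

text \<open>The second premise expresses nondegeneracy of the pairing and gives the definite
  description a unique solution.\<close>

lemma functional_deriv_eqI:
  assumes "(F has_derivative (\<lambda>\<beta>. B \<beta> k)) (at \<alpha>)"
    and "\<And>k'. (\<And>\<beta>. B \<beta> k = B \<beta> k') \<Longrightarrow> k' = k"
  shows "functional_deriv B F \<alpha> = k"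
  unfolding functional_deriv_def frechet_derivative_at[OF assms(1), symmetric]
  by (rule the_equality) (simp_all add: assms(2))

context
  fixes F :: "('v::euclidean_space \<Rightarrow>\<^sub>L real) \<times> 'v \<Rightarrow> real" and \<nu> \<xi> F'
  assumes F: "(F has_derivative F') (at (\<nu>, \<xi>))"
begin

interpretation F': bounded_linear F' using F by (rule has_derivative_bounded_linear)

lemma deriv_nu_has_derivative: "((\<lambda>\<nu>. F (\<nu>, \<xi>)) has_derivative (\<lambda>\<beta>. F' (\<beta>, 0))) (at \<nu>)"
  by (rule has_derivative_compose[where f = "\<lambda>\<nu>. (\<nu>, \<xi>)", OF _ F])
    (intro has_derivative_Pair has_derivative_ident has_derivative_const)

lemma deriv_xi_has_derivative: "((\<lambda>\<xi>. F (\<nu>, \<xi>)) has_derivative (\<lambda>x. F' (0, x))) (at \<xi>)"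
  by (rule has_derivative_compose[where f = "\<lambda>\<xi>. (\<nu>, \<xi>)", OF _ F])
    (intro has_derivative_Pair has_derivative_ident has_derivative_const)

text \<open>Identifying the bidual with the space itself takes a concrete representing vector, whose
  coordinates are the values of F' on the dual basis. The explicit sum also shows how smoothness of
  \<open>F\<close> passes to its functional derivative.\<close>

lemma deriv_nu_eq: "deriv_nu F \<nu> \<xi> = (\<Sum>b\<in>Basis. F' (blinfun_inner_left b, 0) *\<^sub>R b)"
  and F'_nu: "F' (\<beta>, 0) = blinfun_apply \<beta> (deriv_nu F \<nu> \<xi>)"
proof -
  define k where "k = (\<Sum>b\<in>Basis. F' (blinfun_inner_left b, 0) *\<^sub>R b)"
  have F'k: "F' (\<beta>, 0) = blinfun_apply \<beta> k" for \<beta>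
  proof -
    have "(\<beta>, 0) = (\<Sum>b\<in>Basis. blinfun_apply \<beta> b *\<^sub>R (blinfun_inner_left b, 0 :: 'v))"
      by (simp add: prod_eq_iff fst_sum snd_sum blinfun_real_expansion)
    then have "F' (\<beta>, 0) = (\<Sum>b\<in>Basis. blinfun_apply \<beta> b *\<^sub>R F' (blinfun_inner_left b, 0))"
      by (simp only: F'.sum F'.scaleR)
    then show ?thesis by (simp add: k_def blinfun.sum_right blinfun.scaleR_right mult.commute)
  qed
  have "deriv_nu F \<nu> \<xi> = k"
    unfolding deriv_nu_def
  proof (rule functional_deriv_eqI)
    show "((\<lambda>\<nu>. F (\<nu>, \<xi>)) has_derivative (\<lambda>\<beta>. blinfun_apply \<beta> k)) (at \<nu>)"
      using deriv_nu_has_derivative by (simp only: F'k)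
    fix k' assume "\<And>\<beta> :: 'v \<Rightarrow>\<^sub>L real. blinfun_apply \<beta> k = blinfun_apply \<beta> k'"
    from this[of "blinfun_inner_left b" for b] show "k' = k"
      by (metis euclidean_eqI blinfun_inner_left.rep_eq)
  qed
  then show "F' (\<beta>, 0) = blinfun_apply \<beta> (deriv_nu F \<nu> \<xi>)" using F'k[of \<beta>] by simp
  show "deriv_nu F \<nu> \<xi> = (\<Sum>b\<in>Basis. F' (blinfun_inner_left b, 0) *\<^sub>R b)"
    unfolding \<open>deriv_nu F \<nu> \<xi> = k\<close> by (rule k_def)
qed

lemma F'_xi: "F' (0, x) = blinfun_apply (deriv_xi F \<nu> \<xi>) x"
proof -
  have "bounded_linear (\<lambda>x. F' (0, x))"
    using deriv_xi_has_derivative by (rule has_derivative_bounded_linear)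
  then obtain \<mu> where \<mu>: "blinfun_apply \<mu> = (\<lambda>x. F' (0, x))"
    by (metis bounded_linear_Blinfun_apply)
  have "deriv_xi F \<nu> \<xi> = \<mu>"
    unfolding deriv_xi_def
    by (rule functional_deriv_eqI) (use deriv_xi_has_derivative in \<open>auto simp flip: \<mu> intro: blinfun_eqI\<close>)
  with \<mu> show ?thesis by simp
qed

lemma deriv_xi_eq: "deriv_xi F \<nu> \<xi> = (\<Sum>b\<in>Basis. F' (0, b) *\<^sub>R blinfun_inner_left b)"
  by (simp only: F'_xi blinfun_real_expansion)

lemma F'_eq: "F' (\<beta>, x) = blinfun_apply \<beta> (deriv_nu F \<nu> \<xi>) + blinfun_apply (deriv_xi F \<nu> \<xi>) x"
  using F'.add[of "(\<beta>, 0)" "(0, x)"] by (simp add: F'_nu F'_xi)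

text \<open>Linearity splits F' into its restrictions to the two factors, each represented by a
  partial functional derivative. Nondegeneracy follows by testing with pairs that have one zero
  component.\<close>

lemma functional_deriv_semidirect_pairing:
  "functional_deriv semidirect_pairing F (\<nu>, \<xi>) = (deriv_nu F \<nu> \<xi>, deriv_xi F \<nu> \<xi>)"
proof (rule functional_deriv_eqI)
  have "F' = (\<lambda>\<beta>. semidirect_pairing \<beta> (deriv_nu F \<nu> \<xi>, deriv_xi F \<nu> \<xi>))"
    by (auto simp: fun_eq_iff semidirect_pairing_def F'_eq)
  then show "(F has_derivative (\<lambda>\<beta>. semidirect_pairing \<beta> (deriv_nu F \<nu> \<xi>, deriv_xi F \<nu> \<xi>))) (at (\<nu>, \<xi>))"
    using F by simp
  fix k assume k: "\<And>\<beta>. semidirect_pairing \<beta> (deriv_nu F \<nu> \<xi>, deriv_xi F \<nu> \<xi>) = semidirect_pairing \<beta> k"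
  have "b \<bullet> fst k = b \<bullet> deriv_nu F \<nu> \<xi>" for b
    using k[of "(blinfun_inner_left b, 0)"] by (simp add: semidirect_pairing_def case_prod_beta inner_commute)
  then have "fst k = deriv_nu F \<nu> \<xi>" by (metis vector_eq_ldot)
  moreover have "blinfun_apply (snd k) x = blinfun_apply (deriv_xi F \<nu> \<xi>) x" for x
    using k[of "(0, x)"] by (simp add: semidirect_pairing_def case_prod_beta)
  then have "snd k = deriv_xi F \<nu> \<xi>" by (rule blinfun_eqI)
  ultimately show "k = (deriv_nu F \<nu> \<xi>, deriv_xi F \<nu> \<xi>)" by (simp add: prod_eq_iff)
qed

end

section \<open>Smoothness of the partial functional derivatives\<close>

lemma smooth_on_has_derivative:
  "smooth_on S F \<Longrightarrow> x \<in> S \<Longrightarrow> (F has_derivative frechet_derivative F (at x)) (at x)"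
  by (rule k_smooth_on_differentiable[OF smooth_on_imp_k_smooth_on])

lemma smooth_on_frechet_derivative:
  assumes "smooth_on S F"
  shows "k_smooth_on k S (\<lambda>x. frechet_derivative F (at x) v)"
  using smooth_on_imp_k_smooth_on[OF assms, of "Suc k"] by simp

lemma k_smooth_on_deriv_nu:
  fixes F :: "('v::euclidean_space \<Rightarrow>\<^sub>L real) \<times> 'v \<Rightarrow> real"
  assumes "smooth_on UNIV F"
  shows "k_smooth_on k UNIV (\<lambda>p. deriv_nu F (fst p) (snd p))"
proof -
  have eq: "deriv_nu F (fst p) (snd p) = (\<Sum>b\<in>Basis. frechet_derivative F (at p) (blinfun_inner_left b, 0) *\<^sub>R b)" for p
    using deriv_nu_eq[of F _ "fst p" "snd p"] smooth_on_has_derivative[OF assms, of p] by simp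
  show ?thesis
    unfolding eq
    by (intro k_smooth_on_sum k_smooth_on_bounded_linear[OF bounded_linear_scaleR_left]
        smooth_on_frechet_derivative assms open_UNIV)
qed

lemma k_smooth_on_deriv_xi:
  fixes F :: "('v::euclidean_space \<Rightarrow>\<^sub>L real) \<times> 'v \<Rightarrow> real"
  assumes "smooth_on UNIV F"
  shows "k_smooth_on k UNIV (\<lambda>p. deriv_xi F (fst p) (snd p))"
proof -
  have eq: "deriv_xi F (fst p) (snd p) = (\<Sum>b\<in>Basis. frechet_derivative F (at p) (0, b) *\<^sub>R blinfun_inner_left b)" for p
    using deriv_xi_eq[of F _ "fst p" "snd p"] smooth_on_has_derivative[OF assms, of p] by simp
  show ?thesis
    unfolding eq
    by (intro k_smooth_on_sum k_smooth_on_bounded_linear[OF bounded_linear_scaleR_left]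
        smooth_on_frechet_derivative assms open_UNIV)
qed

section \<open>The Lie--Poisson equations\<close>

context lie_chart_one
begin

lemma semidirect_poisson_eq:
  assumes "smooth_on UNIV F" "smooth_on UNIV H"
  shows "semidirect_poisson G \<kappa> F H (\<nu>, \<xi>) =
    blinfun_apply \<nu> (lie_bracket G \<kappa> (deriv_nu F \<nu> \<xi>) (deriv_nu H \<nu> \<xi>)) +
    blinfun_apply (ad_star G \<kappa> (deriv_nu H \<nu> \<xi>) (deriv_xi F \<nu> \<xi>)
      - ad_star G \<kappa> (deriv_nu F \<nu> \<xi>) (deriv_xi H \<nu> \<xi>)) \<xi>"
proof -
  have "functional_deriv semidirect_pairing K (\<nu>, \<xi>) = (deriv_nu K \<nu> \<xi>, deriv_xi K \<nu> \<xi>)"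
    if "smooth_on UNIV K" for K
    using smooth_on_has_derivative[OF that UNIV_I] by (rule functional_deriv_semidirect_pairing)
  then show ?thesis
    using assms by (simp only: semidirect_poisson_def lie_poisson_bracket_def lie_bracket_semidirect
        semidirect_pairing_def prod.case)
qed

definition lie_poisson_field :: "(('v \<Rightarrow>\<^sub>L real) \<times> 'v \<Rightarrow> real) \<Rightarrow> ('v \<Rightarrow>\<^sub>L real) \<times> 'v \<Rightarrow> ('v \<Rightarrow>\<^sub>L real) \<times> 'v" where
  "lie_poisson_field H = (\<lambda>(\<nu>, \<xi>).
     (ad_star G \<kappa> (deriv_nu H \<nu> \<xi>) \<nu> - ad_star G \<kappa> \<xi> (deriv_xi H \<nu> \<xi>),
      lie_bracket G \<kappa> \<xi> (deriv_nu H \<nu> \<xi>)))"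

lemma smooth_on_lie_poisson_field:
  assumes "smooth_on UNIV H"
  shows "smooth_on UNIV (lie_poisson_field H)"
  unfolding smooth_on_def lie_poisson_field_def case_prod_beta'
  by (intro allI k_smooth_on_Pair k_smooth_on_diff open_UNIV
      k_smooth_on_bounded_bilinear[OF bounded_bilinear_ad_star] k_smooth_on_bounded_bilinear[OF bounded_bilinear_lie_bracket]
      k_smooth_on_deriv_nu k_smooth_on_deriv_xi assms
      k_smooth_on_bounded_linear_id[OF bounded_linear_fst] k_smooth_on_bounded_linear_id[OF bounded_linear_snd])

text \<open>Antisymmetry moves the \<nu>-derivative of \<open>F\<close> into the second slot of its
  brackets. The Poisson bracket then becomes minus the sum of two pairings, of the derivatives of
  \<open>F\<close> with the two components of the field.\<close>

lemma hamiltonian_lie_poisson_field: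
  assumes H: "smooth_on UNIV H"
  shows "hamiltonian_vector_field (semidirect_poisson G \<kappa>) H (lie_poisson_field H)"
  unfolding hamiltonian_vector_field_def
proof (intro conjI allI impI smooth_on_lie_poisson_field H)
  fix F :: "('v \<Rightarrow>\<^sub>L real) \<times> 'v \<Rightarrow> real" and \<alpha> :: "('v \<Rightarrow>\<^sub>L real) \<times> 'v"
  assume F: "smooth_on UNIV F"
  obtain \<nu> \<xi> where \<alpha>: "\<alpha> = (\<nu>, \<xi>)" by (cases \<alpha>)
  have "frechet_derivative F (at (\<nu>, \<xi>)) (\<beta>, x) =
      blinfun_apply \<beta> (deriv_nu F \<nu> \<xi>) + blinfun_apply (deriv_xi F \<nu> \<xi>) x" for \<beta> x
    using F'_eq[OF smooth_on_has_derivative[OF F UNIV_I]] .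
  then show "semidirect_poisson G \<kappa> F H \<alpha> = - frechet_derivative F (at \<alpha>) (lie_poisson_field H \<alpha>)"
    unfolding \<alpha> semidirect_poisson_eq[OF F H]
    by (simp add: lie_poisson_field_def ad_star_apply blinfun.bilinear_simps
        lie_bracket_antisym[of \<xi>] lie_bracket_antisym[of "deriv_nu F \<nu> \<xi>" "deriv_nu H \<nu> \<xi>"])
qed

lemma hamiltonian_vector_field_unique:
  assumes "hamiltonian_vector_field P H (X :: ('v \<Rightarrow>\<^sub>L real) \<times> 'v \<Rightarrow> _)" "hamiltonian_vector_field P H Y"
  shows "X = Y"
proof
  fix \<alpha>
  have L: "L (X \<alpha>) = L (Y \<alpha>)" if "bounded_linear L" for L :: "('v \<Rightarrow>\<^sub>L real) \<times> 'v \<Rightarrow> real"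
  proof -
    have "frechet_derivative L (at \<alpha>) = L"
      using frechet_derivative_at[OF bounded_linear_imp_has_derivative[OF that]] by simp
    moreover have "smooth_on UNIV L"
      by (simp add: smooth_on_def k_smooth_on_bounded_linear_id[OF that])
    ultimately show ?thesis using assms unfolding hamiltonian_vector_field_def by (metis neg_equal_iff_equal)
  qed
  \<comment> \<open>Evaluations of the first component at vectors and inner products with the second
    are enough linear functionals to separate points.\<close>
  have "fst (X \<alpha>) = fst (Y \<alpha>)"
    by (intro blinfun_eqI L[of "\<lambda>p. blinfun_apply (fst p) x" for x]
        bounded_linear_compose[OF blinfun.bounded_linear_left bounded_linear_fst])
  moreover have "snd (X \<alpha>) = snd (Y \<alpha>)"
    by (rule euclidean_eqI) (intro L[of "\<lambda>p. snd p \<bullet> x" for x]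
        bounded_linear_compose[OF bounded_linear_inner_left bounded_linear_snd])
  ultimately show "X \<alpha> = Y \<alpha>" by (simp add: prod_eq_iff)
qed

end

lemma has_vector_derivative_Pair_iff:
  "((\<lambda>s. (f s, g s)) has_vector_derivative (f', g')) (at t within S) \<longleftrightarrow>
     (f has_vector_derivative f') (at t within S) \<and> (g has_vector_derivative g') (at t within S)"
  (is "?L \<longleftrightarrow> ?R")
proof
  assume L: ?L
  show ?R
    using bounded_linear.has_vector_derivative[OF bounded_linear_fst L]
      bounded_linear.has_vector_derivative[OF bounded_linear_snd L] by simp
qed (blast intro: has_vector_derivative_Pair)

theorem mainTheorem13:
  fixes G :: "('g, 'v::euclidean_space) lie_group_data"
    and \<kappa> :: "('g, 'v) chart"
  assumes "lie_group G"
    and "\<kappa> \<in> lg_atlas G" and "\<one>\<^bsub>G\<^esub> \<in> fst \<kappa>"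
  shows "(\<forall>F H. smooth_on UNIV F \<longrightarrow> smooth_on UNIV H \<longrightarrow>
            (\<forall>\<nu> \<xi>. semidirect_poisson G \<kappa> F H (\<nu>, \<xi>) =
               blinfun_apply \<nu> (lie_bracket G \<kappa> (deriv_nu F \<nu> \<xi>) (deriv_nu H \<nu> \<xi>)) +
               blinfun_apply (ad_star G \<kappa> (deriv_nu H \<nu> \<xi>) (deriv_xi F \<nu> \<xi>)
                              - ad_star G \<kappa> (deriv_nu F \<nu> \<xi>) (deriv_xi H \<nu> \<xi>)) \<xi>)) \<and>
         (\<forall>H. smooth_on UNIV H \<longrightarrow>
            (\<exists>!X. hamiltonian_vector_field (semidirect_poisson G \<kappa>) H X) \<and>
            (\<forall>X. hamiltonian_vector_field (semidirect_poisson G \<kappa>) H X \<longrightarrow>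
               (\<forall>\<nu> \<xi>. X (\<nu>, \<xi>) =
                  (ad_star G \<kappa> (deriv_nu H \<nu> \<xi>) \<nu> - ad_star G \<kappa> \<xi> (deriv_xi H \<nu> \<xi>),
                   lie_bracket G \<kappa> \<xi> (deriv_nu H \<nu> \<xi>))) \<and>
               (\<forall>\<nu> \<xi> t. ((\<lambda>s. (\<nu> s, \<xi> s)) has_vector_derivative X (\<nu> t, \<xi> t)) (at t) \<longleftrightarrow>
                  (\<nu> has_vector_derivative
                     ad_star G \<kappa> (deriv_nu H (\<nu> t) (\<xi> t)) (\<nu> t)
                     - ad_star G \<kappa> (\<xi> t) (deriv_xi H (\<nu> t) (\<xi> t))) (at t) \<and>
                  (\<xi> has_vector_derivative
                     lie_bracket G \<kappa> (\<xi> t) (deriv_nu H (\<nu> t) (\<xi> t))) (at t))))"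
proof -
  interpret lie_chart_one G \<kappa> using assms by unfold_locales
  \<comment> \<open>Existence, uniqueness and the component formula are all contained in this
    equivalence; the equations of motion then only require splitting the derivative of a
    pair.\<close>
  have X: "hamiltonian_vector_field (semidirect_poisson G \<kappa>) H X \<longleftrightarrow> X = lie_poisson_field H"
    if "smooth_on UNIV H" for H X
    using hamiltonian_lie_poisson_field[OF that] hamiltonian_vector_field_unique by blast
  show ?thesis
    by (simp add: X semidirect_poisson_eq lie_poisson_field_def has_vector_derivative_Pair_iff)
qed

end
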